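(* Let $d\in\mathbb N$, equip $\mathbb R^d$ with the scaling $\mathfrak s=(1,\dots,1)$, and let $0<\alpha<1<\eta<2$. There exists a constant $C>0$ such that for all germs $U$ over $\mathbb R^d$ with $\|U\|_{G^{\eta}(\mathbb R^d)}<\infty$ it holds $$\|U\|_{G^{\eta}(\mathbb R^d)}\le C\big([\Delta U]_{G^{\eta-2}(\mathbb R^d)}+[U]_{G^{\eta,\alpha}(\mathbb R^d)}\big),$$ where $\Delta$ is the Laplacian.
   Context: For a scaling $\mathfrak s\in\mathbb N^d$ and a multi-index $\beta\in\mathbb N_0^d$ set $|\beta|:=\sum_i\mathfrak s_i\beta_i$. The (anisotropic) distance is $d(x,y):=\sum_{i=1}^d|x_i-y_i|^{1/\mathfrak s_i}$ and $B_R(x)$ is the open ball for $d$. For an integer $k$, $\mathcal P_k$ denotes the polynomials $\sum_{|\beta|\le k}c_\beta z^\beta$ on $\mathbb R^d$. A germ over $D\subseteq\mathbb R^d$ is a family $U=(U_x)_{x\in D}$ of continuous functions $U_x:D\to\mathbb C$. For $\eta>0$, $\|U\|_{G^\eta(D)}$ is the infimum of all $M>0$ with $|U_x(y)|\le M\,d(x,y)^\eta$ for all $x,y\in D$. For $0<\alpha<\eta$, $[U]_{G^{\eta,\alpha}(D)}$ is the infimum of all $M>0$ such that for all $x,y\in D$ there is $P\in\mathcal P_{\lfloor\eta\rfloor}$ with $|(U_x-U_y-P)(z)|\le M\,d(y,z)^\alpha(d(x,y)+d(y,z))^{\eta-\alpha}$ for all $z\in D$. For $\gamma<0$, let $k:=\lceil|\gamma|\rceil$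 (absolute value) and let $\mathcal B$ be the set of $\varphi\in C_c^\infty(\mathbb R^d)$ with $\operatorname{supp}\varphi\subseteq B_1(0)$ and $\sup_{|\beta|\le k}\sup|\partial^\beta\varphi|\le 1$. For $x\in\mathbb R^d,\lambda>0$ put $\varphi_x^\lambda(y):=\lambda^{-\sum_i\mathfrak s_i}\varphi(\lambda^{-\mathfrak s_1}(y_1-x_1),\dots,\lambda^{-\mathfrak s_d}(y_d-x_d))$. For an open $D$ and a family $V=(V_x)_{x\in D}$ of distributions $V_x\in\mathcal D'(D)$ (a distribution-valued germ), $[V]_{G^\gamma(D)}:=\sup_{\varphi\in\mathcal B}\sup_{x\in D}\sup_{\lambda>0,\,B_\lambda(x)\subseteq D}\lambda^{-\gamma}|\langle V_x,\varphi_x^\lambda\rangle|$. For a differential operator $\mathcal L$, $\mathcal LU$ denotes the distribution-valued germ $(\mathcal L U_x)_{x}$, with $\mathcal L$ acting distributionally in the active variable (the base point fixed). *)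

theory Defs
  imports "HOL-Analysis.Analysis"
begin

text \<open>Points of R^d are vectors of type real^'n (d = CARD('n)).
  A scaling is a function s :: 'n => nat (with s i >= 1).\<close>

definition sdeg :: "('n::finite \<Rightarrow> nat) \<Rightarrow> ('n \<Rightarrow> nat) \<Rightarrow> nat" where
  "sdeg s \<beta> = (\<Sum>i\<in>UNIV. s i * \<beta> i)"

definition sdist :: "('n::finite \<Rightarrow> nat) \<Rightarrow> real^'n \<Rightarrow> real^'n \<Rightarrow> real" where
  "sdist s x y = (\<Sum>i\<in>UNIV. \<bar>x$i - y$i\<bar> powr (1 / real (s i)))"

definition sball :: "('n::finite \<Rightarrow> nat) \<Rightarrow> real^'n \<Rightarrow> real \<Rightarrow> (real^'n) set" where
  "sball s x R = {y. sdist s x y < R}"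

definition spoly :: "('n::finite \<Rightarrow> nat) \<Rightarrow> nat \<Rightarrow> (('n \<Rightarrow> nat) \<Rightarrow> complex) \<Rightarrow> real^'n \<Rightarrow> complex" where
  "spoly s k c z = (\<Sum>\<beta>\<in>{\<beta>. sdeg s \<beta> \<le> k}. c \<beta> * complex_of_real (\<Prod>i\<in>UNIV. (z$i) ^ \<beta> i))"

definition spolys :: "('n::finite \<Rightarrow> nat) \<Rightarrow> nat \<Rightarrow> (real^'n \<Rightarrow> complex) set" where
  "spolys s k = {spoly s k c | c. True}"

definition partial :: "'n::finite \<Rightarrow> (real^'n \<Rightarrow> real) \<Rightarrow> real^'n \<Rightarrow> real" where
  "partial i f x = frechet_derivative f (at x) (axis i 1)"

fun iter_partial :: "'n::finite list \<Rightarrow> (real^'n \<Rightarrow> real) \<Rightarrow> real^'n \<Rightarrow> real" where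
  "iter_partial [] f = f"
| "iter_partial (i # is) f = partial i (iter_partial is f)"

definition smooth_fun :: "(real^'n::finite \<Rightarrow> real) \<Rightarrow> bool" where
  "smooth_fun f \<longleftrightarrow> (\<forall>is x. iter_partial is f differentiable (at x))"

definition laplacian :: "(real^'n::finite \<Rightarrow> real) \<Rightarrow> real^'n \<Rightarrow> real" where
  "laplacian f x = (\<Sum>i\<in>UNIV. partial i (partial i f) x)"

definition fsupp :: "(real^'n::finite \<Rightarrow> real) \<Rightarrow> (real^'n) set" where
  "fsupp f = closure {x. f x \<noteq> 0}"

text \<open>The class B of test functions for order gamma < 0, with k = ceiling |gamma|.
  A multi-index derivative of scaled order |beta| is an iterated partial along a
  list containing the direction i exactly beta_i times.\<close>
definition testB :: "('n::finite \<Rightarrow> nat) \<Rightarrow> real \<Rightarrow> (real^'n \<Rightarrow> real) set" where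
  "testB s \<gamma> = {\<phi>. smooth_fun \<phi> \<and> compact (fsupp \<phi>) \<and> fsupp \<phi> \<subseteq> sball s 0 1 \<and>
      (\<forall>is x. (\<Sum>i\<leftarrow>is. s i) \<le> nat \<lceil>\<bar>\<gamma>\<bar>\<rceil> \<longrightarrow> \<bar>iter_partial is \<phi> x\<bar> \<le> 1)}"

definition rescale :: "('n::finite \<Rightarrow> nat) \<Rightarrow> (real^'n \<Rightarrow> real) \<Rightarrow> real^'n \<Rightarrow> real \<Rightarrow> real^'n \<Rightarrow> real" where
  "rescale s \<phi> x r y = r powr (- real (\<Sum>i\<in>UNIV. s i)) *
       \<phi> (\<chi> i. r powr (- real (s i)) * (y$i - x$i))"

text \<open>Germs over D = R^d: U x is the function U_x. Norms take values in ennreal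
  (infimum of the empty set is infinity).\<close>
definition G_norm :: "('n::finite \<Rightarrow> nat) \<Rightarrow> real \<Rightarrow> (real^'n \<Rightarrow> real^'n \<Rightarrow> complex) \<Rightarrow> ennreal" where
  "G_norm s \<eta> U = Inf {ennreal M | M. M > 0 \<and>
      (\<forall>x y. norm (U x y) \<le> M * sdist s x y powr \<eta>)}"

definition G_holder :: "('n::finite \<Rightarrow> nat) \<Rightarrow> real \<Rightarrow> real \<Rightarrow> (real^'n \<Rightarrow> real^'n \<Rightarrow> complex) \<Rightarrow> ennreal" where
  "G_holder s \<eta> \<alpha> U = Inf {ennreal M | M. M > 0 \<and>
      (\<forall>x y. \<exists>P\<in>spolys s (nat \<lfloor>\<eta>\<rfloor>). \<forall>z.
         norm (U x z - U y z - P z) \<le> M * sdist s y z powr \<alpha> * (sdist s x y + sdist s y z) powr (\<eta> - \<alpha>))}"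

text \<open>Distribution-valued germs over D = R^d, given by their action on test functions.\<close>
definition G_dist :: "('n::finite \<Rightarrow> nat) \<Rightarrow> real \<Rightarrow> (real^'n \<Rightarrow> (real^'n \<Rightarrow> real) \<Rightarrow> complex) \<Rightarrow> ennreal" where
  "G_dist s \<gamma> V = (SUP (\<phi>, x, r) \<in> {(\<phi>, x, r). \<phi> \<in> testB s \<gamma> \<and> r > 0}.
       ennreal (r powr (- \<gamma>) * norm (V x (rescale s \<phi> x r))))"

definition lap_germ :: "(real^'n::finite \<Rightarrow> real^'n \<Rightarrow> complex) \<Rightarrow> real^'n \<Rightarrow> (real^'n \<Rightarrow> real) \<Rightarrow> complex" where
  "lap_germ U x \<psi> = (LINT y|lborel. U x y * complex_of_real (laplacian \<psi> y))"

end

theory Submission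
  imports Defs
begin

text \<open>Fix a base point \<open>x\<close> and write \<open>u = U\<^sub>x\<close>, placed at the origin. Let
  \<open>\<rho>\<^sub>\<sigma>\<close> be a radial mollifier of width \<open>\<sigma>\<close> and \<open>m\<^sub>\<sigma>(p)\<close> the average of \<open>u\<close> against \<open>\<rho>\<^sub>\<sigma>\<close> around
  \<open>p\<close>. Since the \<open>\<sigma>\<close>-derivative of \<open>\<rho>\<^sub>\<sigma>\<close> is the Laplacian of a test function, averages at a small
  width \<open>\<delta>\<close> and a large width \<open>R\<close> differ by a multiple of the seminorm of \<open>\<Delta>U\<close>. The difference
  of difference quotients \<open>(m\<^sub>\<sigma>(e) - m\<^sub>\<sigma>(0)) - (m\<^sub>\<sigma>(\<epsilon>e) - m\<^sub>\<sigma>(0)) / \<epsilon>\<close> is small relative to \<open>\<parallel>U\<parallel>\<close>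
  for large \<open>\<sigma>\<close>, because the second derivatives of \<open>\<rho>\<^sub>\<sigma>\<close> gain more than the growth of \<open>u\<close> (\<open>\<eta> < 2\<close>).
  For small \<open>\<sigma>\<close> the terms at \<open>0\<close> and \<open>\<epsilon>e\<close> are small because \<open>u\<close> vanishes to order \<open>\<eta> > 1\<close>, while
  \<open>m\<^sub>\<sigma>(e)\<close> is close to \<open>u(e)\<close>: even averaging kills the affine polynomial in the second seminorm. Choosing
  the parameters suitably gives \<open>\<parallel>U\<parallel> \<le> \<parallel>U\<parallel> / 2 + C([\<Delta>U] + [U])\<close>, and \<open>\<parallel>U\<parallel>\<close> is finite.\<close>

section \<open>A smooth cutoff\<close>

text \<open>Indexing by a polynomial in \<open>1 / (1 - t)\<close> makes the family closed under differentiation.\<close>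

definition bump :: "real poly \<Rightarrow> real \<Rightarrow> real" where
  "bump p t = (if t < 1 then poly p (1 / (1 - t)) * exp (- (1 / (1 - t))) else 0)"

text \<open>With s = 1/(1 - t) one has ds/dt = s^2, so p(s) exp(-s) has t-derivative s^2 (p' - p)(s)
  exp(-s).\<close>

definition bump_deriv_poly :: "real poly \<Rightarrow> real poly" where
  "bump_deriv_poly p = [:0, 0, 1:] * (pderiv p - p)"

lemma poly_times_exp_minus_tendsto_0:
  fixes p :: "real poly"
  shows "((\<lambda>x. poly p x * exp (- x)) \<longlongrightarrow> 0) at_top"
proof -
  have "((\<lambda>x. \<Sum>i\<le>degree p. coeff p i * (x ^ i / exp x)) \<longlongrightarrow> (\<Sum>i\<le>degree p. coeff p i * 0)) at_top"
    by (intro tendsto_sum tendsto_mult tendsto_const tendsto_power_div_exp_0)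
  moreover have "(\<lambda>x. \<Sum>i\<le>degree p. coeff p i * (x ^ i / exp x)) = (\<lambda>x. poly p x * exp (- x))"
    by (simp add: poly_altdef exp_minus sum_distrib_right divide_inverse mult.assoc fun_eq_iff)
  ultimately show ?thesis by simp
qed

text \<open>Only t = 1 is delicate: exponential decay beats every polynomial in 1/(1 - t), so the
  left difference quotient tends to zero and matches the right one.\<close>

lemma bump_has_derivative:
  "(bump p has_real_derivative bump (bump_deriv_poly p) t) (at t)"
proof -
  consider "t < 1" | "t = 1" | "t > 1" by linarith
  then show ?thesis
  proof cases
    case 1
    have "((\<lambda>t. poly p (1 / (1 - t)) * exp (- (1 / (1 - t)))) has_real_derivative
        bump (bump_deriv_poly p) t) (at t)"
      using 1
      by (auto intro!: derivative_eq_intros DERIV_chain'[OF _ poly_DERIV]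
          simp: bump_def bump_deriv_poly_def divide_inverse power2_eq_square algebra_simps)
    then show ?thesis
      by (rule has_field_derivative_transform_within_open[where S = "{..<1}"])
        (use 1 in \<open>auto simp: bump_def\<close>)
  next
    case 3
    have "((\<lambda>t. 0) has_real_derivative bump (bump_deriv_poly p) t) (at t)"
      using 3 by (simp add: bump_def)
    then show ?thesis
      by (rule has_field_derivative_transform_within_open[where S = "{1<..}"])
        (use 3 in \<open>auto simp: bump_def\<close>)
  next
    case 2
    have "filterlim (\<lambda>y::real. 1 / (1 - y)) at_top (at_left 1)"
    proof -
      have "filterlim (\<lambda>y::real. inverse (1 - y)) at_top (at_left 1)"
      proof (rule filterlim_compose[OF filterlim_inverse_at_top_right])
        show "filterlim (\<lambda>y::real. 1 - y) (at_right 0) (at_left 1)"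
          unfolding filterlim_at
          by (auto intro!: tendsto_eq_intros simp: eventually_at_filter)
      qed
      then show ?thesis by (simp add: field_simps)
    qed
    \<comment> \<open>With s = 1/(1 - y), dividing by y - 1 is multiplication by -s, hence the extra
      factor \<open>[:0, -1:]\<close>.\<close>
    from filterlim_compose[OF poly_times_exp_minus_tendsto_0[of "[:0, -1:] * p"] this]
    have "((\<lambda>y. poly ([:0, -1:] * p) (1 / (1 - y)) * exp (- (1 / (1 - y)))) \<longlongrightarrow> 0) (at_left 1)" .
    then have L: "((\<lambda>y. (bump p y - bump p 1) / (y - 1)) \<longlongrightarrow> 0) (at_left 1)"
    proof (rule Lim_transform_eventually)
      show "\<forall>\<^sub>F y in at_left 1. poly ([:0, -1:] * p) (1 / (1 - y)) * exp (- (1 / (1 - y))) =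
          (bump p y - bump p 1) / (y - 1)"
        by (auto simp: eventually_at_filter bump_def divide_simps algebra_simps)
    qed
    have R: "((\<lambda>y. (bump p y - bump p 1) / (y - 1)) \<longlongrightarrow> 0) (at_right 1)"
      by (rule tendsto_eventually) (auto simp: eventually_at_filter bump_def)
    from L R have "((\<lambda>y. (bump p y - bump p 1) / (y - 1)) \<longlongrightarrow> 0) (at 1)"
      by (simp add: filterlim_split_at)
    then show ?thesis
      using 2 by (simp add: has_field_derivative_iff bump_def)
  qed
qed

lemma bump_bounded: "\<exists>B>0. \<forall>t\<ge>0. \<bar>bump p t\<bar> \<le> B"
proof -
  have "continuous_on {0..1} (bump p)"
    by (meson DERIV_isCont bump_has_derivative continuous_at_imp_continuous_on)
  then have "bounded (bump p ` {0..1})"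
    by (intro compact_imp_bounded compact_continuous_image) auto
  then obtain B where B: "B > 0" "\<And>t. t \<in> {0..1} \<Longrightarrow> \<bar>bump p t\<bar> \<le> B"
    by (auto simp: bounded_pos)
  have "\<bar>bump p t\<bar> \<le> B" if "t \<ge> 0" for t
    using B that by (cases "t \<le> 1") (auto simp: bump_def)
  then show ?thesis using B by blast
qed

lemma bump_eq_0: "t \<ge> 1 \<Longrightarrow> bump p t = 0"
  by (simp add: bump_def)

lemma bump_1_nonneg: "0 \<le> bump 1 t"
  and bump_1_le_1: "bump 1 t \<le> 1"
  by (auto simp: bump_def)

text \<open>The profile \<open>bump mass_poly\<close> is minus the derivative of
  \<open>bump 1\<close>. With this profile for the mollifier, its scale derivative becomes a
  multiple of the Laplacian of the cutoff.\<close>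

definition mass_poly :: "real poly" where
  "mass_poly = [:0, 0, 1:]"

lemma bump_mass_poly_nonneg: "0 \<le> bump mass_poly t"
  by (auto simp: bump_def mass_poly_def)

lemma bump_uminus: "bump (- p) t = - bump p t"
  by (simp add: bump_def)

lemma bump_deriv_poly_uminus: "bump_deriv_poly (- p) = - bump_deriv_poly p"
  by (simp add: bump_deriv_poly_def pderiv_minus algebra_simps)

lemma bump_deriv_poly_1: "bump_deriv_poly 1 = - mass_poly"
  by (simp add: bump_deriv_poly_def mass_poly_def)

lemma bump_chain [derivative_intros]:
  assumes "(g has_derivative g') (at x)"
  shows "((\<lambda>x. bump p (g x)) has_derivative (\<lambda>h. bump (bump_deriv_poly p) (g x) * g' h)) (at x)"
  using has_derivative_compose[OF assms, of "bump p" "\<lambda>h. bump (bump_deriv_poly p) (g x) * h"]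
    bump_has_derivative[of p "g x"]
  by (simp add: has_field_derivative_def)

lemma continuous_on_bump [continuous_intros]:
  "continuous_on S g \<Longrightarrow> continuous_on S (\<lambda>x. bump p (g x))"
proof -
  assume g: "continuous_on S g"
  have "continuous_on UNIV (bump p)"
    by (meson DERIV_isCont bump_has_derivative continuous_at_imp_continuous_on)
  from continuous_on_compose2[OF this g] show ?thesis by simp
qed

text \<open>An algebra closed under partial derivatives, so all its members are smooth.\<close>

inductive bump_alg :: "real^'n \<Rightarrow> real \<Rightarrow> (real^'n::finite \<Rightarrow> real) \<Rightarrow> bool" for p :: "real^'n" and \<sigma> :: real where
  const: "bump_alg p \<sigma> (\<lambda>_. c)"
| coord: "bump_alg p \<sigma> (\<lambda>w. w $ i)"
| bump: "bump_alg p \<sigma> (\<lambda>w. bump P ((w - p) \<bullet> (w - p) / \<sigma>\<^sup>2))"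
| add: "bump_alg p \<sigma> f \<Longrightarrow> bump_alg p \<sigma> g \<Longrightarrow> bump_alg p \<sigma> (\<lambda>w. f w + g w)"
| mult: "bump_alg p \<sigma> f \<Longrightarrow> bump_alg p \<sigma> g \<Longrightarrow> bump_alg p \<sigma> (\<lambda>w. f w * g w)"

section \<open>Derivatives of radial bumps\<close>

lemma partial_eqI: "(f has_derivative f') (at x) \<Longrightarrow> partial i f x = f' (axis i 1)"
  by (metis frechet_derivative_at partial_def)

lemma has_derivative_bump_ball:
  fixes w :: "real^'n::finite"
  shows "((\<lambda>w. bump P ((w - p) \<bullet> (w - p) / \<sigma>\<^sup>2)) has_derivative
     (\<lambda>h. bump (bump_deriv_poly P) ((w - p) \<bullet> (w - p) / \<sigma>\<^sup>2) * (2 * ((w - p) \<bullet> h) / \<sigma>\<^sup>2))) (at w)"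
proof -
  have "((\<lambda>w. (w - p) \<bullet> (w - p)) has_derivative (\<lambda>h. 2 * ((w - p) \<bullet> h))) (at w)"
    by (auto intro!: derivative_eq_intros simp: inner_commute)
  from bump_chain[OF bounded_linear.has_derivative[OF bounded_linear_divide this]]
  show ?thesis .
qed

lemma partial_bump_ball:
  "partial i (\<lambda>w. bump P ((w - p) \<bullet> (w - p) / \<sigma>\<^sup>2)) w =
     bump (bump_deriv_poly P) ((w - p) \<bullet> (w - p) / \<sigma>\<^sup>2) * (2 * (w $ i - p $ i) / \<sigma>\<^sup>2)"
  by (subst partial_eqI[OF has_derivative_bump_ball]) (simp add: inner_axis)

text \<open>Differentiability and closure go through one induction because the sum and product rules
  presuppose differentiable constituents.\<close>

lemma bump_alg_partial:
  fixes f :: "real^'n::finite \<Rightarrow> real"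
  assumes "bump_alg p \<sigma> f"
  shows "(\<forall>w. f differentiable (at w)) \<and> bump_alg p \<sigma> (partial i f)"
  using assms
proof induction
  case (const c)
  have "partial i (\<lambda>_::real^'n. c) = (\<lambda>_. 0)"
    by (rule ext, subst partial_eqI[OF has_derivative_const]) simp
  then show ?case by (auto intro: bump_alg.const)
next
  case (coord j)
  have *: "((\<lambda>w::real^'n. w $ j) has_derivative (\<lambda>h. h $ j)) (at w)" for w
    by (rule bounded_linear.has_derivative[OF bounded_linear_vec_nth has_derivative_ident])
  have "partial i (\<lambda>w::real^'n. w $ j) = (\<lambda>_. axis i 1 $ j)"
    by (rule ext, subst partial_eqI[OF *]) simp
  then show ?case using * by (auto intro: bump_alg.const simp: differentiable_def)
next
  case (bump P)
  \<comment> \<open>The linear factor is written as a sum with a constant so that the introduction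
    rules of \<open>bump_alg\<close> apply.\<close>
  have "partial i (\<lambda>w. bump P ((w - p) \<bullet> (w - p) / \<sigma>\<^sup>2)) =
     (\<lambda>w. bump (bump_deriv_poly P) ((w - p) \<bullet> (w - p) / \<sigma>\<^sup>2) * ((w $ i + - p $ i) * (2 / \<sigma>\<^sup>2)))"
    by (rule ext) (simp add: partial_bump_ball)
  moreover have "bump_alg p \<sigma> \<dots>"
    by (intro bump_alg.intros)
  ultimately have "bump_alg p \<sigma> (partial i (\<lambda>w. bump P ((w - p) \<bullet> (w - p) / \<sigma>\<^sup>2)))"
    by (simp only:)
  then show ?case
    using has_derivative_bump_ball unfolding differentiable_def by blast
next
  case (add f g)
  have "(f has_derivative frechet_derivative f (at w)) (at w)"
    "(g has_derivative frechet_derivative g (at w)) (at w)" for w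
    using add.IH by (auto simp: frechet_derivative_works)
  then have *: "((\<lambda>w. f w + g w) has_derivative
      (\<lambda>h. frechet_derivative f (at w) h + frechet_derivative g (at w) h)) (at w)" for w
    by (rule has_derivative_add)
  have "partial i (\<lambda>w. f w + g w) = (\<lambda>w. partial i f w + partial i g w)"
    by (rule ext, subst partial_eqI[OF *]) (simp add: partial_def)
  then show ?case using * add.IH by (auto intro!: bump_alg.add simp: differentiable_def)
next
  case (mult f g)
  have "(f has_derivative frechet_derivative f (at w)) (at w)"
    "(g has_derivative frechet_derivative g (at w)) (at w)" for w
    using mult.IH by (auto simp: frechet_derivative_works)
  then have *: "((\<lambda>w. f w * g w) has_derivative
      (\<lambda>h. f w * frechet_derivative g (at w) h + frechet_derivative f (at w) h * g w)) (at w)" for w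
    by (rule has_derivative_mult)
  have "partial i (\<lambda>w. f w * g w) = (\<lambda>w. f w * partial i g w + partial i f w * g w)"
    by (rule ext, subst partial_eqI[OF *]) (simp add: partial_def)
  then show ?case using * mult.IH mult.hyps
    by (auto intro!: bump_alg.add bump_alg.mult simp: differentiable_def)
qed

lemma bump_alg_smooth:
  assumes "bump_alg p \<sigma> f"
  shows "smooth_fun f"
proof -
  have "bump_alg p \<sigma> (iter_partial is f)" for "is"
    by (induction "is") (use assms bump_alg_partial in auto)
  then show ?thesis
    using bump_alg_partial unfolding smooth_fun_def by blast
qed

section \<open>Partial derivatives and Laplacians under multiples and affine substitutions\<close>

lemma partial_cmult:
  assumes "f differentiable (at x)"
  shows "partial i (\<lambda>w. c * f w) x = c * partial i f x"
proof -
  have "(f has_derivative frechet_derivative f (at x)) (at x)"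
    using assms by (simp add: frechet_derivative_works)
  from partial_eqI[OF has_derivative_mult_right[OF this]]
  show ?thesis by (simp add: partial_def)
qed

lemma partial_affine:
  fixes f :: "real^'n::finite \<Rightarrow> real"
  assumes "f differentiable (at (a *\<^sub>R (y - x)))"
  shows "partial i (\<lambda>w. f (a *\<^sub>R (w - x))) y = a * partial i f (a *\<^sub>R (y - x))"
proof -
  let ?D = "frechet_derivative f (at (a *\<^sub>R (y - x)))"
  have D: "(f has_derivative ?D) (at (a *\<^sub>R (y - x)))"
    using assms by (simp add: frechet_derivative_works)
  have "((\<lambda>w. a *\<^sub>R (w - x)) has_derivative (\<lambda>h. a *\<^sub>R h)) (at y)"
    by (auto intro!: derivative_eq_intros)
  from partial_eqI[OF has_derivative_compose[OF this D]]
  have "partial i (\<lambda>w. f (a *\<^sub>R (w - x))) y = ?D (a *\<^sub>R axis i 1)" .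
  also have "\<dots> = a * ?D (axis i 1)"
    using linear_scale[OF has_derivative_linear[OF D], of a "axis i 1"] by simp
  finally show ?thesis by (simp add: partial_def)
qed

lemma differentiable_affine:
  fixes f :: "real^'n::finite \<Rightarrow> real"
  assumes "\<And>z. f differentiable (at z)"
  shows "(\<lambda>w. f (a *\<^sub>R (w - x))) differentiable (at y)"
  by (rule differentiable_compose[where g = "\<lambda>w. a *\<^sub>R (w - x)"])
    (auto intro!: derivative_intros assms)

text \<open>By the chain rule each iterated partial of the composite is a constant multiple of the
  iterated partial of f composed with the affine map; the existence of that constant is the
  induction invariant.\<close>

lemma smooth_fun_affine:
  fixes f :: "real^'n::finite \<Rightarrow> real"
  assumes "smooth_fun f"
  shows "smooth_fun (\<lambda>w. f (a *\<^sub>R (w - x)))"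
proof -
  have d: "iter_partial is f differentiable (at z)" for "is" z
    using assms by (simp add: smooth_fun_def)
  have "\<exists>c. iter_partial is (\<lambda>w. f (a *\<^sub>R (w - x))) = (\<lambda>w. c * iter_partial is f (a *\<^sub>R (w - x)))" for "is"
  proof (induction "is")
    case Nil
    show ?case by (rule exI[of _ 1]) simp
  next
    case (Cons i "is")
    then obtain c where c: "iter_partial is (\<lambda>w. f (a *\<^sub>R (w - x))) = (\<lambda>w. c * iter_partial is f (a *\<^sub>R (w - x)))"
      by blast
    have "partial i (\<lambda>w. c * iter_partial is f (a *\<^sub>R (w - x)))
        = (\<lambda>w. (c * a) * partial i (iter_partial is f) (a *\<^sub>R (w - x)))"
      by (rule ext) (simp only: partial_cmult differentiable_affine d partial_affine mult.assoc)
    then show ?case by (auto simp only: iter_partial.simps c)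
  qed
  moreover have "(\<lambda>w. c * iter_partial is f (a *\<^sub>R (w - x))) differentiable (at y)" for c "is" y
    by (intro differentiable_mult differentiable_const differentiable_affine d)
  ultimately show ?thesis unfolding smooth_fun_def by metis
qed

lemma smooth_funD:
  assumes "smooth_fun f"
  shows "f differentiable (at x)" "partial i f differentiable (at x)"
proof -
  have "iter_partial [] f differentiable (at x)" "iter_partial [i] f differentiable (at x)"
    using assms unfolding smooth_fun_def by blast+
  then show "f differentiable (at x)" "partial i f differentiable (at x)" by simp_all
qed

lemma laplacian_cmult:
  assumes "smooth_fun f"
  shows "laplacian (\<lambda>w. c * f w) x = c * laplacian f x"
proof -
  have "partial i (\<lambda>w. c * f w) = (\<lambda>w. c * partial i f w)" for i
    using partial_cmult smooth_funD(1)[OF assms] by blast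
  then show ?thesis
    by (simp add: laplacian_def partial_cmult smooth_funD[OF assms] sum_distrib_left)
qed

lemma laplacian_affine:
  assumes "smooth_fun f"
  shows "laplacian (\<lambda>w. f (a *\<^sub>R (w - x))) y = a\<^sup>2 * laplacian f (a *\<^sub>R (y - x))"
proof -
  have 1: "partial i (\<lambda>w. f (a *\<^sub>R (w - x))) = (\<lambda>w. a * partial i f (a *\<^sub>R (w - x)))" for i
    using partial_affine smooth_funD(1)[OF assms] by blast
  have 2: "partial i (\<lambda>w. a * partial i f (a *\<^sub>R (w - x))) y
      = a * partial i (\<lambda>w. partial i f (a *\<^sub>R (w - x))) y" for i
    by (intro partial_cmult differentiable_affine smooth_funD(2)[OF assms])
  show ?thesis
    by (simp add: laplacian_def 1 2 partial_affine smooth_funD[OF assms] sum_distrib_left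
        power2_eq_square mult.assoc)
qed

lemma smooth_fun_laplacian_continuous:
  assumes "smooth_fun f"
  shows "continuous_on UNIV (laplacian f)"
proof -
  have "iter_partial [i, i] f differentiable (at x)" for i x
    using assms unfolding smooth_fun_def by blast
  then have "continuous_on UNIV (partial i (partial i f))" for i
    by (auto intro!: continuous_at_imp_continuous_on differentiable_imp_continuous_within)
  then show ?thesis
    unfolding laplacian_def by (intro continuous_on_sum) auto
qed

text \<open>For F(q) with q = |w - p|^2 / \<sigma>^2 the Laplacian is F''(q) |grad q|^2 + F'(q) lap
  q, where |grad q|^2 = 4 q / \<sigma>^2 and lap q = 2 d / \<sigma>^2.\<close>

lemma laplacian_bump_ball:
  fixes p w :: "real^'n::finite"
  shows "laplacian (\<lambda>w. bump P ((w - p) \<bullet> (w - p) / \<sigma>\<^sup>2)) w =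
    (let q = (w - p) \<bullet> (w - p) / \<sigma>\<^sup>2 in
      (4 * q * bump (bump_deriv_poly (bump_deriv_poly P)) q
        + 2 * real CARD('n) * bump (bump_deriv_poly P) q) / \<sigma>\<^sup>2)"
proof -
  let ?q = "\<lambda>w. (w - p) \<bullet> (w - p) / \<sigma>\<^sup>2"
  have 1: "partial i (\<lambda>w. bump P (?q w)) =
      (\<lambda>w. bump (bump_deriv_poly P) (?q w) * (2 * (w $ i - p $ i) / \<sigma>\<^sup>2))" for i
    by (rule ext) (rule partial_bump_ball)
  have c: "((\<lambda>w::real^'n. w $ i) has_derivative (\<lambda>h. h $ i)) (at w)" for w i
    by (rule bounded_linear.has_derivative[OF bounded_linear_vec_nth has_derivative_ident])
  have 2: "partial i (\<lambda>w. bump (bump_deriv_poly P) (?q w) * (2 * (w $ i - p $ i) / \<sigma>\<^sup>2)) w =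
      bump (bump_deriv_poly (bump_deriv_poly P)) (?q w) * (2 * (w $ i - p $ i) / \<sigma>\<^sup>2)\<^sup>2
      + bump (bump_deriv_poly P) (?q w) * (2 / \<sigma>\<^sup>2)" for i
  proof -
    have "((\<lambda>w. 2 * (w $ i - p $ i) / \<sigma>\<^sup>2) has_derivative (\<lambda>h. 2 * h $ i / \<sigma>\<^sup>2)) (at w)"
      by (rule bounded_linear.has_derivative[OF bounded_linear_divide])
        (auto intro!: derivative_eq_intros c)
    from partial_eqI[OF has_derivative_mult[OF has_derivative_bump_ball this]]
    show ?thesis by (simp add: inner_axis power2_eq_square)
  qed
  have q: "?q w = (\<Sum>i\<in>UNIV. (w $ i - p $ i)\<^sup>2) / \<sigma>\<^sup>2"
    by (simp add: inner_vec_def power2_eq_square)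
  have "laplacian (\<lambda>w. bump P (?q w)) w =
      bump (bump_deriv_poly (bump_deriv_poly P)) (?q w) * (\<Sum>i\<in>UNIV. (2 * (w $ i - p $ i) / \<sigma>\<^sup>2)\<^sup>2)
      + real CARD('n) * (bump (bump_deriv_poly P) (?q w) * (2 / \<sigma>\<^sup>2))"
    unfolding laplacian_def 1 2 sum.distrib sum_distrib_left by simp
  also have "(\<Sum>i\<in>UNIV. (2 * (w $ i - p $ i) / \<sigma>\<^sup>2)\<^sup>2) = 4 * ?q w / \<sigma>\<^sup>2"
  proof -
    have "(2 * (w $ i - p $ i) / \<sigma>\<^sup>2)\<^sup>2 = 4 / \<sigma>\<^sup>2 / \<sigma>\<^sup>2 * (w $ i - p $ i)\<^sup>2" for i
      by (simp add: power2_eq_square) (simp add: algebra_simps)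
    then show ?thesis
      unfolding q by (simp only: sum_distrib_left [symmetric]) simp
  qed
  finally show ?thesis
    by (simp add: Let_def add_divide_distrib algebra_simps)
qed

section \<open>Mollification\<close>

lemma lborel_integral_affine:
  fixes f :: "'a::euclidean_space \<Rightarrow> 'b::{banach, second_countable_topology}"
  assumes "c \<noteq> 0" and [measurable]: "f \<in> borel_measurable borel"
  shows "(LINT w|lborel. f w) = \<bar>c\<bar> ^ DIM('a) *\<^sub>R (LINT w|lborel. f (x + c *\<^sub>R w))"
proof -
  have "(LINT w|lborel. f w) =
      (LINT w|density (distr lborel borel (\<lambda>w. x + c *\<^sub>R w)) (\<lambda>_. \<bar>c\<bar> ^ DIM('a)). f w)"
    by (subst lborel_affine[OF assms(1), of x]) (rule refl)
  also have "\<dots> = (LINT w|distr lborel borel (\<lambda>w. x + c *\<^sub>R w). \<bar>c\<bar> ^ DIM('a) *\<^sub>R f w)"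
    by (rule integral_density) auto
  also have "\<dots> = (LINT w|lborel. \<bar>c\<bar> ^ DIM('a) *\<^sub>R f (x + c *\<^sub>R w))"
    by (rule integral_distr) auto
  finally show ?thesis by simp
qed

lemma integrable_continuous_compact_support:
  fixes f :: "'a::euclidean_space \<Rightarrow> 'b::{banach, second_countable_topology}"
  assumes "continuous_on UNIV f" "\<And>w. norm (w - p) > r \<Longrightarrow> f w = 0"
  shows "integrable lborel f"
proof -
  have "integrable lborel (\<lambda>w. indicator (cball p r) w *\<^sub>R f w)"
    by (rule borel_integrable_compact[OF compact_cball]) (use assms continuous_on_subset in blast)
  moreover have "(\<lambda>w. indicator (cball p r) w *\<^sub>R f w) = f"
    using assms(2) by (auto simp: indicator_def fun_eq_iff dist_norm norm_minus_commute)
  ultimately show ?thesis by simp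
qed

text \<open>Passage from the Lebesgue integral to the gauge integral over a box, where the Leibniz
  rule is applied in \<open>moll_diff_le\<close>.\<close>

lemma lborel_integral_eq_integral_cbox:
  fixes f :: "'a::euclidean_space \<Rightarrow> 'b::euclidean_space"
  assumes "integrable lborel f" "\<And>w. w \<notin> cbox a b \<Longrightarrow> f w = 0"
  shows "(LINT w|lborel. f w) = integral (cbox a b) f"
proof -
  have "integral (cbox a b) f = integral UNIV (\<lambda>w. if w \<in> cbox a b then f w else 0)"
    by (rule integral_restrict_UNIV [symmetric])
  also have "(\<lambda>w. if w \<in> cbox a b then f w else 0) = f"
    using assms(2) by auto
  finally show ?thesis using integral_lborel[OF assms(1)] by simp
qed

section \<open>The cutoff, the mollifier and its averages\<close>

definition cutoff :: "real^'n::finite \<Rightarrow> real \<Rightarrow> real^'n \<Rightarrow> real" where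
  "cutoff p \<sigma> w = bump 1 ((w - p) \<bullet> (w - p) / \<sigma>\<^sup>2)"

text \<open>Scaled so that the integral does not depend on \<sigma>, but not normalised to one: the
  common value is \<open>moll_mass\<close>.\<close>

definition moll_kernel :: "real \<Rightarrow> real^'n::finite \<Rightarrow> real" where
  "moll_kernel \<sigma> w = bump mass_poly (w \<bullet> w / \<sigma>\<^sup>2) / \<sigma> ^ CARD('n)"

definition moll :: "(real^'n::finite \<Rightarrow> complex) \<Rightarrow> real \<Rightarrow> real^'n \<Rightarrow> complex" where
  "moll u \<sigma> p = (LINT w|lborel. u w * of_real (moll_kernel \<sigma> (w - p)))"

lemma inner_div_ge_1: "0 < \<sigma> \<Longrightarrow> \<sigma> \<le> norm w \<Longrightarrow> 1 \<le> w \<bullet> w / \<sigma>\<^sup>2"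
  by (simp add: power2_norm_eq_inner [symmetric])

lemma moll_kernel_eq_0: "0 < \<sigma> \<Longrightarrow> \<sigma> \<le> norm w \<Longrightarrow> moll_kernel \<sigma> w = 0"
  by (simp add: moll_kernel_def bump_eq_0[OF inner_div_ge_1])

lemma moll_kernel_nonneg: "0 < \<sigma> \<Longrightarrow> 0 \<le> moll_kernel \<sigma> w"
  by (simp add: moll_kernel_def bump_mass_poly_nonneg)

lemma moll_kernel_minus: "moll_kernel \<sigma> (- w) = moll_kernel \<sigma> w"
  by (simp add: moll_kernel_def)

lemma continuous_on_moll_kernel [continuous_intros]:
  "continuous_on S g \<Longrightarrow> continuous_on S (\<lambda>w. moll_kernel \<sigma> (g w))"
  unfolding moll_kernel_def divide_inverse by (intro continuous_intros)

lemma smooth_cutoff: "smooth_fun (cutoff p \<sigma>)"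
  unfolding cutoff_def[abs_def] by (rule bump_alg_smooth[OF bump_alg.bump])

lemma laplacian_cutoff:
  fixes p w :: "real^'n::finite"
  shows "laplacian (cutoff p \<sigma>) w =
    (let q = (w - p) \<bullet> (w - p) / \<sigma>\<^sup>2 in
      - (4 * q * bump (bump_deriv_poly mass_poly) q + 2 * real CARD('n) * bump mass_poly q) / \<sigma>\<^sup>2)"
  unfolding cutoff_def[abs_def] laplacian_bump_ball
  by (simp add: bump_deriv_poly_1 bump_deriv_poly_uminus bump_uminus)

lemma laplacian_cutoff_eq_0:
  assumes "0 < \<sigma>" "\<sigma> \<le> norm (w - p)"
  shows "laplacian (cutoff p \<sigma>) w = 0"
  using inner_div_ge_1[OF assms] by (simp add: laplacian_cutoff Let_def bump_eq_0)

text \<open>Dilating the kernel changes it by a Laplacian of a compactly supported function: the scale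
  derivative is the divergence of a radial vector field, which is a gradient.\<close>

lemma moll_kernel_has_scale_derivative:
  fixes p w :: "real^'n::finite"
  assumes "\<sigma> > 0"
  shows "((\<lambda>\<sigma>. moll_kernel \<sigma> (w - p)) has_real_derivative
     \<sigma> / (2 * \<sigma> ^ CARD('n)) * laplacian (cutoff p \<sigma>) w) (at \<sigma>)"
proof -
  define b where "b = (w - p) \<bullet> (w - p)"
  \<comment> \<open>Writing the dimension as a successor resolves the truncated exponent
    \<open>CARD('n) - 1\<close> of the power rule.\<close>
  obtain m where m: "CARD('n) = Suc m" by (cases "CARD('n)") auto
  have 1: "((\<lambda>\<sigma>. b / \<sigma>\<^sup>2) has_real_derivative - 2 * b / \<sigma> ^ 3) (at \<sigma>)"
    using assms by (auto intro!: derivative_eq_intros simp: power2_eq_square power3_eq_cube divide_simps)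
  have "((\<lambda>\<sigma>. bump mass_poly (b / \<sigma>\<^sup>2) / \<sigma> ^ CARD('n)) has_real_derivative
     (bump (bump_deriv_poly mass_poly) (b / \<sigma>\<^sup>2) * (- 2 * b / \<sigma> ^ 3) * \<sigma> ^ CARD('n)
       - bump mass_poly (b / \<sigma>\<^sup>2) * (real CARD('n) * \<sigma> ^ (CARD('n) - 1)))
      / (\<sigma> ^ CARD('n) * \<sigma> ^ CARD('n))) (at \<sigma>)"
    using assms
    by (intro DERIV_divide DERIV_chain'[OF 1 bump_has_derivative] DERIV_pow) auto
  \<comment> \<open>With F the profile \<open>bump mass_poly\<close> and q = b / \<sigma>^2, both
    sides equal -(2 q F'(q) + d F(q)) / \<sigma>^(d+1).\<close>
  also have "(bump (bump_deriv_poly mass_poly) (b / \<sigma>\<^sup>2) * (- 2 * b / \<sigma> ^ 3) * \<sigma> ^ CARD('n)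
       - bump mass_poly (b / \<sigma>\<^sup>2) * (real CARD('n) * \<sigma> ^ (CARD('n) - 1)))
      / (\<sigma> ^ CARD('n) * \<sigma> ^ CARD('n)) = \<sigma> / (2 * \<sigma> ^ CARD('n)) * laplacian (cutoff p \<sigma>) w"
    using assms
    by (simp add: laplacian_cutoff Let_def b_def [symmetric] m field_simps power2_eq_square power3_eq_cube)
  finally show ?thesis by (simp add: moll_kernel_def b_def)
qed

section \<open>Mass of the mollifier\<close>

definition moll_mass :: "'n::finite itself \<Rightarrow> real" where
  "moll_mass _ = (LINT w|lborel. moll_kernel 1 (w :: real^'n))"

lemma integrable_moll_kernel:
  assumes "0 < \<sigma>"
  shows "integrable lborel (moll_kernel \<sigma> :: real^'n::finite \<Rightarrow> real)"
  by (rule integrable_continuous_compact_support[where p = 0 and r = \<sigma>])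
    (auto intro!: continuous_intros moll_kernel_eq_0 assms)

lemma integral_moll_kernel:
  assumes "0 < \<sigma>"
  shows "(LINT w|lborel. moll_kernel \<sigma> (w :: real^'n::finite)) = moll_mass TYPE('n)"
proof -
  have [measurable]: "(moll_kernel \<sigma> :: real^'n \<Rightarrow> real) \<in> borel_measurable borel"
    by (intro borel_measurable_continuous_onI continuous_intros)
  have "(LINT w|lborel. moll_kernel \<sigma> (w :: real^'n))
      = \<sigma> ^ CARD('n) * (LINT w|lborel. moll_kernel \<sigma> (\<sigma> *\<^sub>R (w :: real^'n)))"
    using lborel_integral_affine[of \<sigma> "moll_kernel \<sigma> :: real^'n \<Rightarrow> real" 0] assms by simp
  also have "\<dots> = (LINT w|lborel. \<sigma> ^ CARD('n) * moll_kernel \<sigma> (\<sigma> *\<^sub>R (w :: real^'n)))"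
    by simp
  also have "\<dots> = moll_mass TYPE('n)"
    unfolding moll_mass_def using assms
    by (intro Bochner_Integration.integral_cong) (auto simp: moll_kernel_def power2_eq_square)
  finally show ?thesis .
qed

text \<open>If the integral of the nonnegative kernel were zero, its closed zero set would have full
  measure and so contain the origin, where the kernel is exp(-1).\<close>

lemma moll_mass_pos: "moll_mass TYPE('n::finite) > 0"
proof -
  let ?f = "moll_kernel 1 :: real^'n \<Rightarrow> real"
  have "moll_mass TYPE('n) \<noteq> 0"
  proof
    assume "moll_mass TYPE('n) = 0"
    then have "AE w in lborel. ?f w = 0"
      using integral_nonneg_eq_0_iff_AE[OF integrable_moll_kernel[of 1, where 'n='n]]
      by (simp add: moll_mass_def moll_kernel_nonneg)
    then have "AE w in lebesgue. w \<in> {w. ?f w = 0}"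
      by (intro AE_completion) simp
    moreover have "closed {w. ?f w = 0}"
      by (intro closed_Collect_eq continuous_intros)
    ultimately have "0 \<in> {w. ?f w = 0}"
      by (intro mem_closed_if_AE_lebesgue)
    then show False by (simp add: moll_kernel_def bump_def mass_poly_def)
  qed
  moreover have "moll_mass TYPE('n) \<ge> 0"
    unfolding moll_mass_def by (intro Bochner_Integration.integral_nonneg) (simp add: moll_kernel_nonneg)
  ultimately show ?thesis by simp
qed

section \<open>Averages of a continuous function\<close>

lemma continuous_on_mult_of_real_compose:
  fixes u :: "real^'n::finite \<Rightarrow> complex"
  assumes "continuous_on UNIV u" "continuous_on UNIV g" "continuous_on UNIV h"
  shows "continuous_on UNIV (\<lambda>w. u (g w) * complex_of_real (h w))"
  by (intro continuous_intros continuous_on_compose2[OF assms(1,2)] assms(3)) auto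

lemma integrable_moll:
  fixes u :: "real^'n::finite \<Rightarrow> complex"
  assumes "continuous_on UNIV u" "0 < \<sigma>"
  shows "integrable lborel (\<lambda>w. u w * of_real (moll_kernel \<sigma> (w - p)))"
  by (rule integrable_continuous_compact_support[where p = p and r = \<sigma>])
    (auto intro!: continuous_on_mult_of_real_compose continuous_intros moll_kernel_eq_0 assms)

text \<open>Differentiation in \<sigma> under the integral produces \<open>u\<close> tested against
  the Laplacian of a cutoff, times \<sigma> / (2 \<sigma>^d). The mean value inequality on
  [\<delta>, R] then applies, with that factor bounded by taking R above and \<delta> below the
  fraction bar.\<close>

lemma moll_diff_le:
  fixes u :: "real^'n::finite \<Rightarrow> complex"
  assumes u: "continuous_on UNIV u" and \<delta>: "0 < \<delta>" "\<delta> \<le> R"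
    and B: "\<And>\<sigma>. \<delta> \<le> \<sigma> \<Longrightarrow> \<sigma> \<le> R \<Longrightarrow>
      norm (LINT w|lborel. u w * of_real (laplacian (cutoff p \<sigma>) w)) \<le> B"
  shows "norm (moll u R p - moll u \<delta> p) \<le> R / (2 * \<delta> ^ CARD('n)) * B * (R - \<delta>)"
proof -
  \<comment> \<open>One box contains the supports for all widths up to R, so the domain of
    integration does not vary with \<sigma>.\<close>
  obtain a where a: "cball p R \<subseteq> cbox (- a) a"
    using bounded_subset_cbox_symmetric[OF bounded_cball] by metis
  have out: "norm (w - p) \<ge> \<sigma>" if "w \<notin> cbox (- a) a" "\<sigma> \<le> R" for w \<sigma>
    using that a by (force simp: dist_norm norm_minus_commute)
  define c where "c \<sigma> = \<sigma> / (2 * \<sigma> ^ CARD('n))" for \<sigma> :: real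
  define k where "k \<sigma> w = u w * of_real (moll_kernel \<sigma> (w - p))" for \<sigma> w
  define k' where "k' \<sigma> w = u w * of_real (c \<sigma> * laplacian (cutoff p \<sigma>) w)" for \<sigma> w
  have moll_eq: "moll u \<sigma> p = integral (cbox (- a) a) (k \<sigma>)" if "\<sigma> \<in> {\<delta>..R}" for \<sigma>
    unfolding moll_def k_def
    using that \<delta> out by (intro lborel_integral_eq_integral_cbox integrable_moll u) (auto simp: moll_kernel_eq_0)
  have k'_eq: "integral (cbox (- a) a) (k' \<sigma>)
      = c \<sigma> * (LINT w|lborel. u w * of_real (laplacian (cutoff p \<sigma>) w))" if "\<sigma> \<in> {\<delta>..R}" for \<sigma>
  proof -
    have "integral (cbox (- a) a) (k' \<sigma>) = (LINT w|lborel. k' \<sigma> w)"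
    proof (rule lborel_integral_eq_integral_cbox [symmetric])
      show "integrable lborel (k' \<sigma>)"
        unfolding k'_def using that \<delta>
        by (intro integrable_continuous_compact_support[where p = p and r = \<sigma>])
          (auto intro!: continuous_on_mult_of_real_compose[OF u] continuous_intros
             smooth_fun_laplacian_continuous smooth_cutoff laplacian_cutoff_eq_0 u simp del: of_real_mult)
      show "k' \<sigma> w = 0" if "w \<notin> cbox (- a) a" for w
        using out[OF that, of \<sigma>] \<open>\<sigma> \<in> {\<delta>..R}\<close> \<delta> by (simp add: k'_def laplacian_cutoff_eq_0)
    qed
    also have "\<dots> = (LINT w|lborel. c \<sigma> * (u w * of_real (laplacian (cutoff p \<sigma>) w)))"
      by (simp add: k'_def mult_ac)
    also have "\<dots> = c \<sigma> * (LINT w|lborel. u w * of_real (laplacian (cutoff p \<sigma>) w))"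
      by (rule integral_mult_right_zero)
    finally show ?thesis .
  qed
  have deriv: "((\<lambda>\<sigma>. integral (cbox (- a) a) (k \<sigma>)) has_vector_derivative
      integral (cbox (- a) a) (k' \<sigma>)) (at \<sigma> within {\<delta>..R})" if "\<sigma> \<in> {\<delta>..R}" for \<sigma>
  proof (rule leibniz_rule_vector_derivative)
    fix \<sigma> w assume "\<sigma> \<in> {\<delta>..R}"
    then have "\<sigma> > 0" using \<delta> by auto
    from moll_kernel_has_scale_derivative[OF this, of w p]
    have "((\<lambda>\<sigma>. moll_kernel \<sigma> (w - p)) has_vector_derivative c \<sigma> * laplacian (cutoff p \<sigma>) w) (at \<sigma> within {\<delta>..R})"
      unfolding c_def has_real_derivative_iff_has_vector_derivative
      by (rule has_vector_derivative_at_within)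
    then have "((\<lambda>\<sigma>. of_real (moll_kernel \<sigma> (w - p))) has_vector_derivative
        complex_of_real (c \<sigma> * laplacian (cutoff p \<sigma>) w)) (at \<sigma> within {\<delta>..R})"
      by (rule bounded_linear.has_vector_derivative[OF bounded_linear_of_real])
    then show "((\<lambda>\<sigma>. k \<sigma> w) has_vector_derivative k' \<sigma> w) (at \<sigma> within {\<delta>..R})"
      unfolding k_def k'_def by (rule has_vector_derivative_mult_right)
  next
    show "k \<sigma> integrable_on cbox (- a) a" for \<sigma>
      unfolding k_def
      by (intro integrable_continuous continuous_on_subset[OF continuous_on_mult_of_real_compose[OF u]])
        (auto intro!: continuous_intros)
  next
    \<comment> \<open>The explicit formula makes joint continuity in \<sigma> and w visible, as the
      Leibniz rule demands; \<sigma> stays away from zero.\<close>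
    have *: "laplacian (cutoff p \<sigma>) w = (let q = (w - p) \<bullet> (w - p) / \<sigma>\<^sup>2 in
      - (4 * q * bump (bump_deriv_poly mass_poly) q + 2 * real CARD('n) * bump mass_poly q) / \<sigma>\<^sup>2)" for \<sigma> w
      by (rule laplacian_cutoff)
    show "continuous_on ({\<delta>..R} \<times> cbox (- a) a) (\<lambda>(\<sigma>, w). k' \<sigma> w)"
      unfolding k'_def split_beta c_def * Let_def using \<delta>
      by (intro continuous_intros continuous_on_compose2[OF u]) auto
  qed (use that in auto)
  have "norm (integral (cbox (- a) a) (k R) - integral (cbox (- a) a) (k \<delta>)) \<le>
      R / (2 * \<delta> ^ CARD('n)) * B * norm (R - \<delta>)"
  proof (rule differentiable_bound[where S = "{\<delta>..R}"])
    fix \<sigma> assume \<sigma>: "\<sigma> \<in> {\<delta>..R}"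
    show "((\<lambda>\<sigma>. integral (cbox (- a) a) (k \<sigma>)) has_derivative
        (\<lambda>h. h *\<^sub>R integral (cbox (- a) a) (k' \<sigma>))) (at \<sigma> within {\<delta>..R})"
      using deriv[OF \<sigma>] by (simp add: has_vector_derivative_def)
    have c: "0 \<le> c \<sigma>" "c \<sigma> \<le> R / (2 * \<delta> ^ CARD('n))"
      using \<sigma> \<delta> unfolding c_def by (auto intro!: frac_le power_mono)
    have "norm (integral (cbox (- a) a) (k' \<sigma>)) \<le> R / (2 * \<delta> ^ CARD('n)) * B"
      unfolding k'_eq[OF \<sigma>] norm_mult norm_of_real
      using c B[of \<sigma>] \<sigma> by (intro mult_mono) auto
    then show "onorm (\<lambda>h. h *\<^sub>R integral (cbox (- a) a) (k' \<sigma>)) \<le> R / (2 * \<delta> ^ CARD('n)) * B"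
      by (intro onorm_le) (metis abs_ge_zero mult.commute mult_left_mono norm_scaleR real_norm_def)
  qed (use \<delta> in auto)
  then show ?thesis using moll_eq \<delta> by simp
qed

text \<open>The reflected form holds because the kernel is even. Adding the two forms turns an
  average into an average of second differences.\<close>

lemma moll_shift:
  fixes u :: "real^'n::finite \<Rightarrow> complex"
  assumes u: "continuous_on UNIV u"
  shows "moll u \<sigma> p = (LINT w|lborel. u (p + w) * of_real (moll_kernel \<sigma> w))"
    and "moll u \<sigma> p = (LINT w|lborel. u (p - w) * of_real (moll_kernel \<sigma> w))"
proof -
  have [measurable]: "(\<lambda>w. u w * of_real (moll_kernel \<sigma> (w - p))) \<in> borel_measurable borel"
    by (intro borel_measurable_continuous_onI continuous_on_mult_of_real_compose u continuous_intros)
  show "moll u \<sigma> p = (LINT w|lborel. u (p + w) * of_real (moll_kernel \<sigma> w))"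
    unfolding moll_def by (subst lborel_integral_affine[of 1 _ p]) auto
  show "moll u \<sigma> p = (LINT w|lborel. u (p - w) * of_real (moll_kernel \<sigma> w))"
    unfolding moll_def by (subst lborel_integral_affine[of "-1" _ p]) (auto simp: moll_kernel_minus)
qed

lemma norm_integral_kernel_le:
  fixes f :: "real^'n::finite \<Rightarrow> complex"
  assumes f: "continuous_on UNIV f" and \<sigma>: "0 < \<sigma>" and T: "\<And>w. norm w \<le> \<sigma> \<Longrightarrow> norm (f w) \<le> T"
  shows "norm (LINT w|lborel. f w * of_real (moll_kernel \<sigma> w)) \<le> moll_mass TYPE('n) * T"
proof -
  have "norm (LINT w|lborel. f w * of_real (moll_kernel \<sigma> w)) \<le> (LINT w|lborel. T * moll_kernel \<sigma> (w::real^'n))"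
  proof (rule Bochner_Integration.integral_norm_bound_integral)
    show "integrable lborel (\<lambda>w. f w * of_real (moll_kernel \<sigma> w))"
      using integrable_moll[OF f \<sigma>, of 0] by simp
    show "integrable lborel (\<lambda>w. T * moll_kernel \<sigma> (w::real^'n))"
      by (intro integrable_mult_right integrable_moll_kernel \<sigma>)
    show "norm (f w * of_real (moll_kernel \<sigma> w)) \<le> T * moll_kernel \<sigma> w" for w
      using T[of w] moll_kernel_eq_0[OF \<sigma>, of w] moll_kernel_nonneg[OF \<sigma>, of w]
      by (cases "norm w \<le> \<sigma>") (auto simp: norm_mult intro!: mult_right_mono)
  qed
  also have "\<dots> = moll_mass TYPE('n) * T"
    using integral_moll_kernel[OF \<sigma>, where 'n='n] by simp
  finally show ?thesis .
qed

lemma norm_moll_le: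
  fixes u :: "real^'n::finite \<Rightarrow> complex"
  assumes u: "continuous_on UNIV u" and \<sigma>: "0 < \<sigma>"
    and T: "\<And>w. norm w \<le> \<sigma> \<Longrightarrow> norm (u (p + w)) \<le> T"
  shows "norm (moll u \<sigma> p) \<le> moll_mass TYPE('n) * T"
  unfolding moll_shift(1)[OF u]
  by (rule norm_integral_kernel_le[OF _ \<sigma> T])
    (auto intro!: continuous_on_compose2[OF u] continuous_intros)

text \<open>Half the sum of the two forms in \<open>moll_shift\<close> shows that the error is half
  the kernel integral of the second difference at p. Thus \<open>u\<close> need not be
  differentiable, and affine parts drop out.\<close>

lemma moll_approx:
  fixes u :: "real^'n::finite \<Rightarrow> complex"
  assumes u: "continuous_on UNIV u" and \<sigma>: "0 < \<sigma>"
    and T: "\<And>w. norm w \<le> \<sigma> \<Longrightarrow> norm (u (p + w) + u (p - w) - 2 * u p) \<le> T"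
  shows "norm (moll u \<sigma> p - moll_mass TYPE('n) * u p) \<le> moll_mass TYPE('n) * T / 2"
proof -
  have i: "integrable lborel (\<lambda>w. f w * of_real (moll_kernel \<sigma> w))" if "continuous_on UNIV f"
    for f :: "real^'n \<Rightarrow> complex"
    using integrable_moll[OF that \<sigma>, of 0] by simp
  have c: "continuous_on UNIV (\<lambda>w. u (p + w))" "continuous_on UNIV (\<lambda>w. u (p - w))"
    by (auto intro!: continuous_on_compose2[OF u] continuous_intros)
  have "(LINT w|lborel. (u (p + w) + u (p - w) - 2 * u p) * of_real (moll_kernel \<sigma> w)) =
      (LINT w|lborel. u (p + w) * of_real (moll_kernel \<sigma> w))
      + (LINT w|lborel. u (p - w) * of_real (moll_kernel \<sigma> w))
      - (LINT w|lborel. 2 * u p * of_real (moll_kernel \<sigma> (w::real^'n)))"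
    unfolding ring_distribs
    by (subst Bochner_Integration.integral_diff Bochner_Integration.integral_add;
        (intro Bochner_Integration.integrable_add i c continuous_on_const)?)+ simp
  also have "(LINT w|lborel. 2 * u p * of_real (moll_kernel \<sigma> (w::real^'n))) = 2 * u p * moll_mass TYPE('n)"
    using integral_moll_kernel[OF \<sigma>, where 'n='n] by simp
  finally have *: "(LINT w|lborel. (u (p + w) + u (p - w) - 2 * u p) * of_real (moll_kernel \<sigma> w)) =
      2 * (moll u \<sigma> p - moll_mass TYPE('n) * u p)"
    by (simp only: moll_shift(1)[OF u, symmetric] moll_shift(2)[OF u, symmetric])
      (simp add: algebra_simps)
  have "norm (2 * (moll u \<sigma> p - moll_mass TYPE('n) * u p)) \<le> moll_mass TYPE('n) * T"
    unfolding * [symmetric]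
    by (rule norm_integral_kernel_le[OF _ \<sigma> T]) (auto intro!: continuous_intros c)
  then show ?thesis unfolding norm_mult by simp
qed

text \<open>Along t -> z - t e both quotients are values of the first derivative at points of (0,
  1), so they differ by at most the supremum of the second derivative. K does not depend on
  \<epsilon>, which keeps the later choice of \<epsilon> free.\<close>

lemma moll_kernel_difference_quotients:
  assumes R: "R > 0"
  obtains K where "K > 0" "\<And>(z :: real^'n::finite) e \<epsilon>. 0 < \<epsilon> \<Longrightarrow> \<epsilon> \<le> 1 \<Longrightarrow>
    \<bar>(moll_kernel R (z - e) - moll_kernel R z)
      - (moll_kernel R (z - \<epsilon> *\<^sub>R e) - moll_kernel R z) / \<epsilon>\<bar> \<le> K * (norm e)\<^sup>2"
proof -
  define D1 where "D1 = bump_deriv_poly mass_poly"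
  define D2 where "D2 = bump_deriv_poly D1"
  obtain B1 where B1: "B1 > 0" "\<And>t. t \<ge> 0 \<Longrightarrow> \<bar>bump D1 t\<bar> \<le> B1" using bump_bounded by blast
  obtain B2 where B2: "B2 > 0" "\<And>t. t \<ge> 0 \<Longrightarrow> \<bar>bump D2 t\<bar> \<le> B2" using bump_bounded by blast
  \<comment> \<open>Put q(t) = |z - t e|^2 / R^2. Inside the support |q'| <= 2 |e| / R, and q'' = 2
    |e|^2 / R^2; hence (F''(q) q'^2 + F'(q) q'') / R^d is at most K |e|^2, with B1 and B2 bounding
    F' and F''.\<close>
  define K where "K = (B2 * 4 / R\<^sup>2 + B1 * 2 / R\<^sup>2) / R ^ CARD('n)"
  have "K > 0" using B1 B2 R unfolding K_def by (auto intro!: divide_pos_pos add_pos_pos)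
  moreover have "\<bar>(moll_kernel R (z - e) - moll_kernel R z)
      - (moll_kernel R (z - \<epsilon> *\<^sub>R e) - moll_kernel R z) / \<epsilon>\<bar> \<le> K * (norm e)\<^sup>2"
    if \<epsilon>: "0 < \<epsilon>" "\<epsilon> \<le> 1" for z e :: "real^'n" and \<epsilon>
  proof -
    define q where "q t = (z - t *\<^sub>R e) \<bullet> (z - t *\<^sub>R e) / R\<^sup>2" for t
    define q1 where "q1 t = - 2 * ((z - t *\<^sub>R e) \<bullet> e) / R\<^sup>2" for t
    define f where "f t = moll_kernel R (z - t *\<^sub>R e)" for t
    define f1 where "f1 t = bump D1 (q t) * q1 t / R ^ CARD('n)" for t
    define f2 where "f2 t = (bump D2 (q t) * (q1 t)\<^sup>2 + bump D1 (q t) * (2 * (e \<bullet> e) / R\<^sup>2)) / R ^ CARD('n)" for t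
    have q: "(q has_real_derivative q1 t) (at t)" for t
    proof -
      have "q = (\<lambda>t. (z \<bullet> z - 2 * t * (z \<bullet> e) + t\<^sup>2 * (e \<bullet> e)) / R\<^sup>2)"
        by (rule ext) (simp add: q_def inner_diff inner_commute power2_eq_square algebra_simps)
      moreover have "q1 t = (- 2 * (z \<bullet> e) + 2 * t * (e \<bullet> e)) / R\<^sup>2"
        by (simp add: q1_def inner_diff algebra_simps)
      moreover have "((\<lambda>t. (z \<bullet> z - 2 * t * (z \<bullet> e) + t\<^sup>2 * (e \<bullet> e)) / R\<^sup>2) has_real_derivative
          (- 2 * (z \<bullet> e) + 2 * t * (e \<bullet> e)) / R\<^sup>2) (at t)"
        by (rule DERIV_cdivide) (auto intro!: derivative_eq_intros)
      ultimately show ?thesis by simp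
    qed
    have q1: "(q1 has_real_derivative 2 * (e \<bullet> e) / R\<^sup>2) (at t)" for t
    proof -
      have "q1 = (\<lambda>t. (- 2 * (z \<bullet> e) + 2 * t * (e \<bullet> e)) / R\<^sup>2)"
        by (rule ext) (simp add: q1_def inner_diff algebra_simps)
      moreover have "((\<lambda>t. (- 2 * (z \<bullet> e) + 2 * t * (e \<bullet> e)) / R\<^sup>2) has_real_derivative
          2 * (e \<bullet> e) / R\<^sup>2) (at t)"
        by (rule DERIV_cdivide) (auto intro!: derivative_eq_intros)
      ultimately show ?thesis by simp
    qed
    have f: "(f has_real_derivative f1 t) (at t)" for t
      unfolding f_def[abs_def] f1_def D1_def moll_kernel_def q_def[symmetric]
      by (rule DERIV_cdivide[OF DERIV_chain'[OF q bump_has_derivative]])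
    have f1: "(f1 has_real_derivative f2 t) (at t)" for t
    proof -
      have "((\<lambda>t. bump D1 (q t) * q1 t / R ^ CARD('n)) has_real_derivative
          (bump D1 (q t) * (2 * (e \<bullet> e) / R\<^sup>2) + (bump (bump_deriv_poly D1) (q t) * q1 t) * q1 t) / R ^ CARD('n)) (at t)"
        by (rule DERIV_cdivide[OF DERIV_mult'[OF DERIV_chain'[OF q bump_has_derivative] q1]])
      then show ?thesis
        unfolding f1_def[abs_def] f2_def D2_def power2_eq_square by (simp add: algebra_simps)
    qed
    \<comment> \<open>The bound on q' is available only within distance R of the centre; beyond it
      the profiles vanish.\<close>
    have f2: "\<bar>f2 t\<bar> \<le> K * (norm e)\<^sup>2" for t
    proof (cases "R \<le> norm (z - t *\<^sub>R e)")
      case True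
      then have "f2 t = 0"
        using inner_div_ge_1[OF R, of "z - t *\<^sub>R e"] by (simp add: f2_def q_def bump_eq_0)
      then show ?thesis using \<open>K > 0\<close> by simp
    next
      case False
      have "\<bar>q1 t\<bar> = 2 * \<bar>(z - t *\<^sub>R e) \<bullet> e\<bar> / R\<^sup>2"
        by (simp add: q1_def abs_mult)
      also have "\<dots> \<le> 2 * (R * norm e) / R\<^sup>2"
        using False R
        by (intro divide_right_mono mult_left_mono order.trans[OF Cauchy_Schwarz_ineq2] mult_right_mono) auto
      also have "\<dots> = 2 * norm e / R" using R by (simp add: power2_eq_square)
      finally have "(q1 t)\<^sup>2 \<le> (2 * norm e / R)\<^sup>2"
        by (rule power2_le_iff_abs_le[THEN iffD2, rotated]) (use R in simp)
      then have q1b: "(q1 t)\<^sup>2 \<le> 4 / R\<^sup>2 * (norm e)\<^sup>2"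
        by (simp add: power_divide power_mult_distrib)
      have "q t \<ge> 0" by (simp add: q_def)
      then have "\<bar>bump D2 (q t)\<bar> * (q1 t)\<^sup>2 \<le> B2 * (4 / R\<^sup>2 * (norm e)\<^sup>2)"
        "\<bar>bump D1 (q t)\<bar> * (2 * (e \<bullet> e) / R\<^sup>2) \<le> B1 * (2 * (e \<bullet> e) / R\<^sup>2)"
        using q1b B1 B2 by (auto intro!: mult_mono simp del: times_divide_eq_left times_divide_eq_right)
      then have "\<bar>bump D2 (q t) * (q1 t)\<^sup>2 + bump D1 (q t) * (2 * (e \<bullet> e) / R\<^sup>2)\<bar>
          \<le> B2 * (4 / R\<^sup>2 * (norm e)\<^sup>2) + B1 * (2 * (e \<bullet> e) / R\<^sup>2)"
        by (intro order.trans[OF abs_triangle_ineq] add_mono) (simp_all add: abs_mult)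
      also have "\<dots> = (B2 * 4 / R\<^sup>2 + B1 * 2 / R\<^sup>2) * (norm e)\<^sup>2"
        by (simp add: power2_norm_eq_inner algebra_simps)
      finally show ?thesis
        using R by (simp add: f2_def K_def divide_right_mono)
    qed
    \<comment> \<open>The mean value theorem turns each quotient into a value of \<open>f1\<close>;
      the two points are less than 1 apart.\<close>
    obtain t1 where t1: "0 < t1" "t1 < 1" "f 1 - f 0 = f1 t1"
      using MVT2[of 0 1 f f1] f by auto
    obtain t2 where t2: "0 < t2" "t2 < \<epsilon>" "f \<epsilon> - f 0 = \<epsilon> * f1 t2"
      using MVT2[of 0 \<epsilon> f f1] f \<epsilon> by auto
    have "norm (f1 t1 - f1 t2) \<le> K * (norm e)\<^sup>2 * norm (t1 - t2)"
      by (rule field_differentiable_bound[where S = UNIV and f' = f2]) (use f1 f2 in auto)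
    also have "\<dots> \<le> K * (norm e)\<^sup>2 * 1"
      using t1 t2 \<epsilon> \<open>K > 0\<close> by (intro mult_left_mono) auto
    finally have "\<bar>(f 1 - f 0) - (f \<epsilon> - f 0) / \<epsilon>\<bar> \<le> K * (norm e)\<^sup>2"
      using t1 t2 \<epsilon> by simp
    then show ?thesis by (simp add: f_def)
  qed
  ultimately show ?thesis by (rule that)
qed

section \<open>The distance of the unit scaling as a norm\<close>

definition l1 :: "real^'n::finite \<Rightarrow> real" where
  "l1 w = (\<Sum>i\<in>UNIV. \<bar>w $ i\<bar>)"

lemma l1_nonneg: "0 \<le> l1 w"
  by (simp add: l1_def sum_nonneg)

lemma norm_le_l1: "norm w \<le> l1 w"
  unfolding l1_def by (rule norm_le_l1_cart)

lemma l1_le_norm: "l1 (w :: real^'n::finite) \<le> real CARD('n) * norm w"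
proof -
  have "l1 w \<le> (\<Sum>i\<in>(UNIV :: 'n set). norm w)"
    unfolding l1_def by (intro sum_mono component_le_norm_cart)
  then show ?thesis by simp
qed

lemma l1_triangle: "l1 (v + w) \<le> l1 v + l1 w"
  unfolding l1_def by (simp add: sum.distrib [symmetric] sum_mono abs_triangle_ineq)

lemma l1_scaleR: "l1 (c *\<^sub>R w) = \<bar>c\<bar> * l1 w"
  unfolding l1_def by (simp add: abs_mult sum_distrib_left)

lemma sdist_eq_l1: "sdist (\<lambda>_. 1) x y = l1 (y - x)"
  by (simp add: sdist_def l1_def abs_minus_commute)

text \<open>The l1 norm is at most d times the Euclidean one, so the sum is at most 1/2 + 1/4. This
  allows cutoffs centred at p to serve as test functions based at the origin.\<close>

lemma l1_less_1:
  fixes w p :: "real^'n::finite"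
  assumes "norm (w - p) \<le> 1 / (2 * real CARD('n))" "l1 p \<le> 1 / 4"
  shows "l1 w < 1"
proof -
  have "l1 w \<le> l1 (w - p) + l1 p"
    using l1_triangle[of "w - p" p] by simp
  also have "l1 (w - p) \<le> real CARD('n) * norm (w - p)"
    by (rule l1_le_norm)
  also have "\<dots> \<le> real CARD('n) * (1 / (2 * real CARD('n)))"
    by (intro mult_left_mono assms) auto
  also have "\<dots> = 1 / 2" by simp
  finally show ?thesis using assms by simp
qed

text \<open>The kernel bound is integrated against \<open>u\<close>: all kernels involved live in
  the l1 unit ball, where |u| <= N. The final constant carries the volume of the Euclidean unit
  ball.\<close>

lemma moll_difference_quotients:
  assumes R: "0 < R" "R \<le> 1 / (2 * real CARD('n::finite))"
  obtains K where "K > 0"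
    "\<And>(u :: real^'n \<Rightarrow> complex) N e \<epsilon>. continuous_on UNIV u \<Longrightarrow> (\<And>w. l1 w \<le> 1 \<Longrightarrow> norm (u w) \<le> N) \<Longrightarrow>
       l1 e \<le> 1 / 4 \<Longrightarrow> 0 < \<epsilon> \<Longrightarrow> \<epsilon> \<le> 1 \<Longrightarrow>
       norm ((moll u R e - moll u R 0) - (moll u R (\<epsilon> *\<^sub>R e) - moll u R 0) / of_real \<epsilon>) \<le> K * N * (l1 e)\<^sup>2"
proof -
  obtain K where K: "K > 0" "\<And>(z :: real^'n) e \<epsilon>. 0 < \<epsilon> \<Longrightarrow> \<epsilon> \<le> 1 \<Longrightarrow>
    \<bar>(moll_kernel R (z - e) - moll_kernel R z)
      - (moll_kernel R (z - \<epsilon> *\<^sub>R e) - moll_kernel R z) / \<epsilon>\<bar> \<le> K * (norm e)\<^sup>2"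
    using moll_kernel_difference_quotients[OF R(1), where 'n='n] by metis
  define V where "V = measure lborel (cball (0 :: real^'n) 1)"
  have "V > 0" unfolding V_def by (rule content_cball_pos) auto
  have "norm ((moll u R e - moll u R 0) - (moll u R (\<epsilon> *\<^sub>R e) - moll u R 0) / of_real \<epsilon>)
      \<le> K * V * N * (l1 e)\<^sup>2"
    if u: "continuous_on UNIV u" and N: "\<And>w. l1 w \<le> 1 \<Longrightarrow> norm (u w) \<le> N"
      and e: "l1 e \<le> 1 / 4" and \<epsilon>: "0 < \<epsilon>" "\<epsilon> \<le> 1"
    for u :: "real^'n \<Rightarrow> complex" and N e \<epsilon>
  proof -
    have "N \<ge> 0" using order.trans[OF norm_ge_zero N[of 0]] by (simp add: l1_def)
    define k where "k w = (moll_kernel R (w - e) - moll_kernel R w)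
      - (moll_kernel R (w - \<epsilon> *\<^sub>R e) - moll_kernel R w) / \<epsilon>" for w
    let ?m = "\<lambda>p w. u w * complex_of_real (moll_kernel R (w - p))"
    have i: "integrable lborel (?m p)" for p by (rule integrable_moll[OF u R(1)])
    have uk: "u w * of_real (k w) = (?m e w - ?m 0 w) - (?m (\<epsilon> *\<^sub>R e) w - ?m 0 w) / of_real \<epsilon>" for w
      by (simp add: k_def algebra_simps diff_divide_distrib)
    have int_uk: "integrable lborel (\<lambda>w. u w * of_real (k w))"
      unfolding uk by (intro Bochner_Integration.integrable_diff integrable_divide_zero i)
    have eq: "(LINT w|lborel. u w * of_real (k w))
        = (moll u R e - moll u R 0) - (moll u R (\<epsilon> *\<^sub>R e) - moll u R 0) / of_real \<epsilon>"
      unfolding uk moll_def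
      by (subst Bochner_Integration.integral_diff Bochner_Integration.integral_divide_zero;
          (intro Bochner_Integration.integrable_diff integrable_divide_zero i)?)+ simp
    have fin: "emeasure lborel (cball (0::real^'n) 1) < \<infinity>"
      by (rule emeasure_lborel_cball_finite)
    have "norm (LINT w|lborel. u w * of_real (k w))
        \<le> (LINT w|lborel. (N * (K * (l1 e)\<^sup>2)) * indicator (cball (0::real^'n) 1) w)"
    proof (rule Bochner_Integration.integral_norm_bound_integral[OF int_uk])
      show "integrable lborel (\<lambda>w. (N * (K * (l1 e)\<^sup>2)) * indicator (cball (0::real^'n) 1) w)"
        using fin by (intro integrable_mult_right integrable_real_indicator) auto
      fix w :: "real^'n"
      show "norm (u w * of_real (k w)) \<le> (N * (K * (l1 e)\<^sup>2)) * indicator (cball 0 1) w"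
      proof (cases "k w = 0")
        case True
        then show ?thesis using \<open>N \<ge> 0\<close> K(1) by (simp add: indicator_def)
      next
        case False
        \<comment> \<open>Where the combined kernel is nonzero, w lies within R of e, 0 or
          \<epsilon> e, hence in the l1 unit ball.\<close>
        then have "moll_kernel R (w - e) \<noteq> 0 \<or> moll_kernel R (w - 0) \<noteq> 0 \<or> moll_kernel R (w - \<epsilon> *\<^sub>R e) \<noteq> 0"
          by (auto simp: k_def)
        then obtain p where p: "moll_kernel R (w - p) \<noteq> 0" "p \<in> {e, 0, \<epsilon> *\<^sub>R e}" by blast
        have "l1 p \<le> 1 / 4"
          using p(2) e \<epsilon> mult_mono[of \<epsilon> 1 "l1 e" "1/4"] l1_nonneg[of e]
          by (auto simp: l1_scaleR) (simp add: l1_def)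
        moreover have "norm (w - p) \<le> 1 / (2 * real CARD('n))"
          using p(1) moll_kernel_eq_0[OF R(1), of "w - p"] R(2) by force
        ultimately have w: "l1 w < 1" using l1_less_1 by blast
        have "\<bar>k w\<bar> \<le> K * (norm e)\<^sup>2"
          unfolding k_def by (rule K(2)[OF \<epsilon>])
        also have "\<dots> \<le> K * (l1 e)\<^sup>2"
          using K(1) norm_le_l1[of e] by (intro mult_left_mono power_mono) auto
        finally have "norm (u w * of_real (k w)) \<le> N * (K * (l1 e)\<^sup>2)"
          unfolding norm_mult norm_of_real using N[of w] w \<open>N \<ge> 0\<close> by (intro mult_mono) auto
        moreover have "w \<in> cball 0 1" using norm_le_l1[of w] w by simp
        ultimately show ?thesis by simp
      qed
    qed
    also have "\<dots> = K * V * N * (l1 e)\<^sup>2"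
      using fin by (simp add: V_def)
    finally show ?thesis unfolding eq .
  qed
  with that[of "K * V"] \<open>V > 0\<close> K(1) show ?thesis by simp
qed

text \<open>Only the function and its first partials have to be bounded, since the derivative order
  is 1. All centres p near the origin are tested against the same base point, so a single function
  of the germ can be averaged at 0, \<epsilon> e and e.\<close>

lemma cutoff_scaled_in_testB:
  assumes \<gamma>: "nat \<lceil>\<bar>\<gamma>\<bar>\<rceil> = 1" and \<delta>: "\<delta> > 0"
  obtains M where "M > 0"
    "\<And>(p :: real^'n::finite) \<sigma>. \<delta> \<le> \<sigma> \<Longrightarrow> \<sigma> \<le> 1 / (2 * real CARD('n)) \<Longrightarrow> l1 p \<le> 1 / 4 \<Longrightarrow>
      (\<lambda>w. 1 / M * cutoff p \<sigma> w) \<in> testB (\<lambda>_. 1) \<gamma>"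
proof -
  obtain B where B: "B > 0" "\<And>t. t \<ge> 0 \<Longrightarrow> \<bar>bump (bump_deriv_poly 1) t\<bar> \<le> B"
    using bump_bounded by blast
  \<comment> \<open>The cutoff is at most 1 and its first partials are at most 2 B / \<sigma> <= 2 B
    / \<delta>.\<close>
  define M where "M = 1 + 2 * B / \<delta>"
  have M: "M \<ge> 1" "2 * B / \<delta> \<le> M" using B \<delta> by (auto simp: M_def)
  have "(\<lambda>w. 1 / M * cutoff p \<sigma> w) \<in> testB (\<lambda>_. 1) \<gamma>"
    if \<sigma>: "\<delta> \<le> \<sigma>" "\<sigma> \<le> 1 / (2 * real CARD('n))" and p: "l1 p \<le> 1 / 4" for p :: "real^'n" and \<sigma>
  proof -
    have "\<sigma> > 0" using \<sigma> \<delta> by simp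
    let ?\<phi> = "\<lambda>w. 1 / M * cutoff p \<sigma> w"
    have smooth: "smooth_fun ?\<phi>"
      unfolding cutoff_def by (rule bump_alg_smooth[OF bump_alg.mult[OF bump_alg.const bump_alg.bump]])
    have "{w. ?\<phi> w \<noteq> 0} \<subseteq> cball p \<sigma>"
      using inner_div_ge_1[OF \<open>\<sigma> > 0\<close>]
      by (force simp: cutoff_def dist_norm norm_minus_commute intro: bump_eq_0)
    then have sub: "fsupp ?\<phi> \<subseteq> cball p \<sigma>"
      unfolding fsupp_def by (rule closure_minimal) auto
    then have "compact (fsupp ?\<phi>)"
      unfolding fsupp_def using compact_eq_bounded_closed bounded_subset[OF bounded_cball] by blast
    moreover have "fsupp ?\<phi> \<subseteq> sball (\<lambda>_. 1) 0 1"
    proof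
      fix w assume "w \<in> fsupp ?\<phi>"
      then have "norm (w - p) \<le> 1 / (2 * real CARD('n))"
        using sub \<sigma> by (auto simp: dist_norm norm_minus_commute)
      then show "w \<in> sball (\<lambda>_. 1) 0 1"
        unfolding sball_def sdist_eq_l1 using l1_less_1 p by auto
    qed
    moreover have "\<bar>iter_partial is ?\<phi> x\<bar> \<le> 1" if "(\<Sum>i\<leftarrow>is. 1) \<le> (1::nat)" for "is" x
    proof -
      have *: "1 / M * t \<le> 1" if "t \<le> M" for t using that M by (simp add: divide_simps)
      have "length is \<le> 1" using that by (simp add: sum_list_triv)
      then consider "is = []" | i where "is = [i]" by (cases "is") auto
      then show ?thesis
      proof cases
        case 1
        then show ?thesis
          using M bump_1_nonneg bump_1_le_1 *[of "cutoff p \<sigma> x"] by (auto simp: cutoff_def intro: order.trans)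
      next
        case (2 i)
        let ?q = "(x - p) \<bullet> (x - p) / \<sigma>\<^sup>2"
        have eq: "partial i ?\<phi> x = 1 / M * (bump (bump_deriv_poly 1) ?q * (2 * (x $ i - p $ i) / \<sigma>\<^sup>2))"
          using partial_cmult[OF smooth_funD(1)[OF smooth_cutoff], of i "1 / M" p \<sigma> x]
          by (simp add: cutoff_def[abs_def] partial_bump_ball)
        have "\<bar>bump (bump_deriv_poly 1) ?q * (2 * (x $ i - p $ i) / \<sigma>\<^sup>2)\<bar> \<le> 2 * B / \<delta>"
        proof (cases "\<sigma> \<le> norm (x - p)")
          case True
          then show ?thesis
            using inner_div_ge_1[OF \<open>\<sigma> > 0\<close>, of "x - p"] B \<delta> by (simp add: bump_eq_0)
        next
          case False
          have "\<bar>x $ i - p $ i\<bar> \<le> \<sigma>"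
            using component_le_norm_cart[of "x - p" i] False by simp
          then have "\<bar>2 * (x $ i - p $ i) / \<sigma>\<^sup>2\<bar> \<le> 2 * \<sigma> / \<sigma>\<^sup>2"
            by (simp add: divide_right_mono)
          also have "\<dots> = 2 / \<sigma>" by (simp add: power2_eq_square)
          also have "\<dots> \<le> 2 / \<delta>" using \<sigma> \<delta> by (intro divide_left_mono) auto
          finally have "\<bar>2 * (x $ i - p $ i) / \<sigma>\<^sup>2\<bar> \<le> 2 / \<delta>" .
          from mult_mono[OF B(2)[of ?q] this] B(1) show ?thesis by (simp add: abs_mult mult.commute)
        qed
        with M(2) have "1 / M * \<bar>bump (bump_deriv_poly 1) ?q * (2 * (x $ i - p $ i) / \<sigma>\<^sup>2)\<bar> \<le> 1"
          by (intro *) linarith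
        moreover have "\<bar>1 / M\<bar> = 1 / M" using M by simp
        ultimately have "\<bar>partial i ?\<phi> x\<bar> \<le> 1"
          unfolding eq abs_mult[of "1 / M"] by simp
        then show ?thesis using 2 by simp
      qed
    qed
    ultimately show ?thesis using smooth \<gamma> by (simp add: testB_def)
  qed
  then show ?thesis using that[of M] M by auto
qed

section \<open>The a priori estimate\<close>

lemma small_powr_exists:
  fixes a b m :: real
  assumes "0 \<le> a" "0 < b" "0 < m"
  obtains x where "0 < x" "x \<le> m" "a * x powr b \<le> 1 / 4"
proof -
  \<comment> \<open>y solves 4 (a + 1) y^b = 1; the added 1 covers a = 0.\<close>
  define y where "y = (1 / (4 * (a + 1))) powr (1 / b)"
  define x where "x = min m y"
  have "y > 0" using assms by (simp add: y_def)
  then have x: "0 < x" "x \<le> m" "x \<le> y" using assms by (auto simp: x_def)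
  have "x powr b \<le> y powr b" using x assms by (intro powr_mono2) auto
  also have "\<dots> = 1 / (4 * (a + 1))" using assms by (simp add: y_def powr_powr)
  finally have "a * x powr b \<le> a * (1 / (4 * (a + 1)))" using assms by (intro mult_left_mono) auto
  also have "\<dots> \<le> 1 / 4" using assms by (simp add: divide_simps)
  finally show ?thesis using that x by blast
qed

text \<open>A germ at one base point, translated to the origin and rescaled so that the point \<open>e\<close> under
  consideration is much closer to the origin than the unit scale of the test functions; \<open>N\<close>, \<open>A\<close>
  and \<open>H\<close> bound the three seminorms. The polynomials have been eliminated by taking second
  differences.\<close>

definition pointwise_bounds ::
    "real \<Rightarrow> real \<Rightarrow> (real^'n::finite \<Rightarrow> complex) \<Rightarrow> real^'n \<Rightarrow> real \<Rightarrow> real \<Rightarrow> real \<Rightarrow> bool" where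
  "pointwise_bounds \<alpha> \<eta> u e N A H \<longleftrightarrow> continuous_on UNIV u \<and> 0 \<le> N \<and> 0 \<le> A \<and> 0 \<le> H \<and>
     (\<forall>w. norm (u w) \<le> N * l1 w powr \<eta>) \<and>
     (\<forall>w. norm (u (e + w) + u (e - w) - 2 * u e)
        \<le> 2 * N * l1 w powr \<eta> + 2 * H * (l1 w powr \<alpha> * (l1 e + l1 w) powr (\<eta> - \<alpha>))) \<and>
     (\<forall>\<phi>\<in>testB (\<lambda>_. 1) (\<eta> - 2). norm (LINT w|lborel. u w * of_real (laplacian \<phi> w)) \<le> A)"

text \<open>Order of choice: R by the dimension, K by R, then \<kappa> by K and \<epsilon> by the
  dimension and \<eta>, then \<delta>, and last M and C. Everything that multiplies A or H may be
  large; only the factors of N have to be small.\<close>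

lemma pointwise_estimate:
  fixes \<alpha> \<eta> :: real
  assumes \<alpha>: "0 < \<alpha>" "\<alpha> < 1" and \<eta>: "1 < \<eta>" "\<eta> < 2"
  obtains \<kappa> C where "0 < \<kappa>" "0 < C"
    "\<And>(u :: real^'n::finite \<Rightarrow> complex) e N A H. pointwise_bounds \<alpha> \<eta> u e N A H \<Longrightarrow> l1 e = \<kappa> \<Longrightarrow>
      norm (u e) \<le> \<kappa> powr \<eta> * N / 2 + C * (A + H)"
proof -
  define d where "d = real CARD('n)"
  have d: "d \<ge> 1" by (simp add: d_def Suc_leI)
  define c where "c = moll_mass TYPE('n)"
  have c: "c > 0" unfolding c_def by (rule moll_mass_pos)
  define R where "R = 1 / (2 * d)"
  have R: "0 < R" "R \<le> 1 / (2 * real CARD('n))" using d by (auto simp: R_def d_def)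
  define Y where "Y = (d + 1) powr \<eta>"
  have Y: "Y > 0" using d by (simp add: Y_def)
  obtain K where K: "K > 0"
    "\<And>(u :: real^'n \<Rightarrow> complex) N e \<epsilon>. continuous_on UNIV u \<Longrightarrow> (\<And>w. l1 w \<le> 1 \<Longrightarrow> norm (u w) \<le> N) \<Longrightarrow>
       l1 e \<le> 1 / 4 \<Longrightarrow> 0 < \<epsilon> \<Longrightarrow> \<epsilon> \<le> 1 \<Longrightarrow>
       norm ((moll u R e - moll u R 0) - (moll u R (\<epsilon> *\<^sub>R e) - moll u R 0) / of_real \<epsilon>) \<le> K * N * (l1 e)\<^sup>2"
    using moll_difference_quotients[OF R] by blast
  \<comment> \<open>The error K \<kappa>^2 N / c of the wide averages must cost at most a quarter of
    \<kappa>^\<eta> N; this is where \<eta> < 2 enters.\<close>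
  obtain \<kappa> where \<kappa>: "0 < \<kappa>" "\<kappa> \<le> 1 / (4 * d)" "K / c * \<kappa> powr (2 - \<eta>) \<le> 1 / 4"
    using small_powr_exists[of "K / c" "2 - \<eta>" "1 / (4 * d)"] K(1) c \<eta> d by auto
  \<comment> \<open>Values near the origin are of size (\<epsilon> \<kappa>)^\<eta> and get divided
    by \<epsilon>; the remaining power \<epsilon>^(\<eta> - 1) is small because \<eta> > 1.\<close>
  obtain \<epsilon> where \<epsilon>: "0 < \<epsilon>" "\<epsilon> \<le> 1" "4 * Y * \<epsilon> powr (\<eta> - 1) \<le> 1 / 4"
    using small_powr_exists[of "4 * Y" "\<eta> - 1" 1] Y \<eta> by auto
  \<comment> \<open>The small width equals the l1 distance of \<epsilon> e from the origin.\<close>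
  define \<delta> where "\<delta> = \<epsilon> * \<kappa>"
  have \<kappa>4: "\<kappa> \<le> 1 / 4" using \<kappa> d by (smt (verit) frac_le)
  have \<delta>: "0 < \<delta>" "\<delta> \<le> \<kappa>" "\<delta> \<le> R"
  proof -
    show "0 < \<delta>" using \<epsilon> \<kappa> by (simp add: \<delta>_def)
    show "\<delta> \<le> \<kappa>" using mult_right_mono[OF \<epsilon>(2), of \<kappa>] \<kappa> by (simp add: \<delta>_def)
    also have "\<kappa> \<le> R" using \<kappa>(2) unfolding R_def by (rule order.trans) (use d in \<open>auto intro!: frac_le\<close>)
    finally show "\<delta> \<le> R" .
  qed
  have \<gamma>: "nat \<lceil>\<bar>\<eta> - 2\<bar>\<rceil> = 1"
  proof -
    have "\<lceil>\<bar>\<eta> - 2\<bar>\<rceil> = 1" using \<eta> by (intro ceiling_unique) auto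
    then show ?thesis by simp
  qed
  obtain M where M: "M > 0"
    "\<And>(p :: real^'n::finite) \<sigma>. \<delta> \<le> \<sigma> \<Longrightarrow> \<sigma> \<le> 1 / (2 * real CARD('n)) \<Longrightarrow> l1 p \<le> 1 / 4 \<Longrightarrow>
      (\<lambda>w. 1 / M * cutoff p \<sigma> w) \<in> testB (\<lambda>_. 1) (\<eta> - 2)"
    using cutoff_scaled_in_testB[OF \<gamma> \<delta>(1)] by blast
  define D where "D = R / (2 * \<delta> ^ CARD('n)) * M * (R - \<delta>)"
  have D: "D \<ge> 0" using R M(1) \<delta> by (simp add: D_def)
  define C where "C = Y + D / c * (2 + 2 / \<epsilon>)"
  have C: "C > 0" "Y \<le> C" "D / c * (2 + 2 / \<epsilon>) \<le> C"
    using Y D c \<epsilon> by (auto simp: C_def add_pos_nonneg)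
  have "norm (u e) \<le> \<kappa> powr \<eta> * N / 2 + C * (A + H)"
    if pb: "pointwise_bounds \<alpha> \<eta> u e N A H" and e: "l1 e = \<kappa>" for u :: "real^'n \<Rightarrow> complex" and e N A H
  proof -
    have u: "continuous_on UNIV u" and NAH: "0 \<le> N" "0 \<le> A" "0 \<le> H"
      and growth: "norm (u w) \<le> N * l1 w powr \<eta>"
      and second: "norm (u (e + w) + u (e - w) - 2 * u e)
         \<le> 2 * N * l1 w powr \<eta> + 2 * H * (l1 w powr \<alpha> * (\<kappa> + l1 w) powr (\<eta> - \<alpha>))"
      and lap: "\<phi> \<in> testB (\<lambda>_. 1) (\<eta> - 2) \<Longrightarrow> norm (LINT w|lborel. u w * of_real (laplacian \<phi> w)) \<le> A"
      for w \<phi>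
      using pb unfolding pointwise_bounds_def e by blast+
    \<comment> \<open>\<open>N * Q\<close> bounds |u| on the l1 ball of radius (d + 1) \<delta>:
      \<epsilon> e has l1 norm \<delta>, and averaging over Euclidean radius \<delta> reaches at
      most d \<delta> further.\<close>
    define Q where "Q = ((d + 1) * \<delta>) powr \<eta>"
    have w\<delta>: "l1 w \<le> d * \<delta>" if "norm w \<le> \<delta>" for w :: "real^'n"
      using order.trans[OF l1_le_norm mult_left_mono[OF that]] by (simp add: d_def)
    have Q_bound: "norm (u v) \<le> N * Q" if "l1 v \<le> (d + 1) * \<delta>" for v
      using order.trans[OF growth[of v] mult_left_mono[OF powr_mono2[OF _ l1_nonneg that, of \<eta>] NAH(1)]] \<eta>
      by (simp add: Q_def)
    have near0: "norm (moll u \<delta> 0) \<le> c * (N * Q)"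
      unfolding c_def
    proof (rule norm_moll_le[OF u \<delta>(1)])
      fix w :: "real^'n" assume "norm w \<le> \<delta>"
      from w\<delta>[OF this] show "norm (u (0 + w)) \<le> N * Q"
        using \<delta> by (intro Q_bound) (simp add: algebra_simps)
    qed
    have near1: "norm (moll u \<delta> (\<epsilon> *\<^sub>R e)) \<le> c * (N * Q)"
      unfolding c_def
    proof (rule norm_moll_le[OF u \<delta>(1)])
      fix w :: "real^'n" assume "norm w \<le> \<delta>"
      have "l1 (\<epsilon> *\<^sub>R e + w) \<le> \<delta> + d * \<delta>"
        using l1_triangle[of "\<epsilon> *\<^sub>R e" w] w\<delta>[OF \<open>norm w \<le> \<delta>\<close>] \<epsilon> e by (simp add: l1_scaleR \<delta>_def)
      then show "norm (u (\<epsilon> *\<^sub>R e + w)) \<le> N * Q"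
        by (intro Q_bound) (simp add: algebra_simps)
    qed
    have near2: "norm (moll u \<delta> e - c * u e) \<le> c * (2 * N * Q + 2 * H * Y) / 2"
      unfolding c_def
    proof (rule moll_approx[OF u \<delta>(1)])
      fix w :: "real^'n" assume "norm w \<le> \<delta>"
      from w\<delta>[OF this] have w: "l1 w \<le> d * \<delta>" .
      have "d * \<delta> \<le> (d + 1) * \<delta>" using \<delta> by simp
      then have "l1 w powr \<eta> \<le> Q"
        unfolding Q_def using w l1_nonneg[of w] \<eta> by (intro powr_mono2) auto
      \<comment> \<open>No smallness is sought for the factor of H, so both distances are crudely
        bounded by d + 1.\<close>
      moreover have "l1 w powr \<alpha> * (\<kappa> + l1 w) powr (\<eta> - \<alpha>) \<le> Y"
      proof -
        have "d * \<delta> \<le> d * 1" using d \<delta> \<kappa>4 by (intro mult_left_mono) auto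
        then have "l1 w powr \<alpha> * (\<kappa> + l1 w) powr (\<eta> - \<alpha>) \<le> (d + 1) powr \<alpha> * (d + 1) powr (\<eta> - \<alpha>)"
          using w l1_nonneg[of w] \<alpha> \<eta> \<kappa>(1) \<kappa>4 by (intro mult_mono powr_mono2) auto
        also have "\<dots> = Y" using d by (simp add: Y_def flip: powr_add)
        finally show ?thesis .
      qed
      ultimately show "norm (u (e + w) + u (e - w) - 2 * u e) \<le> 2 * N * Q + 2 * H * Y"
        using NAH by (intro order.trans[OF second] add_mono mult_left_mono) auto
    qed
    have scales: "norm (moll u R p - moll u \<delta> p) \<le> D * A" if p: "l1 p \<le> 1 / 4" for p
    proof -
      have "norm (moll u R p - moll u \<delta> p) \<le> R / (2 * \<delta> ^ CARD('n)) * (M * A) * (R - \<delta>)"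
      proof (rule moll_diff_le[OF u \<delta>(1,3)])
        fix \<sigma> assume \<sigma>: "\<delta> \<le> \<sigma>" "\<sigma> \<le> R"
        \<comment> \<open>Division by M makes the cutoff an admissible test function; the factor M
          returns in the bound.\<close>
        have "norm (LINT w|lborel. u w * of_real (laplacian (\<lambda>w. 1 / M * cutoff p \<sigma> w) w)) \<le> A"
          using \<sigma> R p by (intro lap M(2)) auto
        also have "(LINT w|lborel. u w * of_real (laplacian (\<lambda>w. 1 / M * cutoff p \<sigma> w) w)) =
            (LINT w|lborel. of_real (1 / M) * (u w * of_real (laplacian (cutoff p \<sigma>) w)))"
          by (simp only: laplacian_cmult[OF smooth_cutoff] of_real_mult mult_ac)
        also have "\<dots> = of_real (1 / M) * (LINT w|lborel. u w * of_real (laplacian (cutoff p \<sigma>) w))"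
          by (rule integral_mult_right_zero)
        finally show "norm (LINT w|lborel. u w * of_real (laplacian (cutoff p \<sigma>) w)) \<le> M * A"
          unfolding norm_mult norm_of_real using M(1) by (simp add: field_simps)
      qed
      then show ?thesis by (simp add: D_def mult_ac)
    qed
    have far: "norm ((moll u R e - moll u R 0) - (moll u R (\<epsilon> *\<^sub>R e) - moll u R 0) / of_real \<epsilon>) \<le> K * N * \<kappa>\<^sup>2"
    proof -
      have "norm (u w) \<le> N" if "l1 w \<le> 1" for w
      proof -
        have "l1 w powr \<eta> \<le> 1" using that l1_nonneg[of w] \<eta> by (intro powr_le1) auto
        from order.trans[OF growth mult_left_mono[OF this NAH(1)]] show ?thesis by simp
      qed
      from K(2)[OF u this, of e \<epsilon>] show ?thesis using e \<kappa>4 \<epsilon> by simp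
    qed
    have l1_pts: "l1 e \<le> 1 / 4" "l1 (0 :: real^'n) \<le> 1 / 4" "l1 (\<epsilon> *\<^sub>R e) \<le> 1 / 4"
      using e \<kappa>4 \<delta> \<epsilon> by (auto simp: l1_scaleR \<delta>_def) (simp add: l1_def)
    have R0: "norm (moll u R 0) \<le> c * (N * Q) + D * A"
      using norm_triangle_sub[of "moll u R 0" "moll u \<delta> 0"] scales[OF l1_pts(2)] near0 by linarith
    have R1: "norm (moll u R (\<epsilon> *\<^sub>R e)) \<le> c * (N * Q) + D * A"
      using norm_triangle_sub[of "moll u R (\<epsilon> *\<^sub>R e)" "moll u \<delta> (\<epsilon> *\<^sub>R e)"] scales[OF l1_pts(3)] near1 by linarith
    define quot where "quot = (moll u R (\<epsilon> *\<^sub>R e) - moll u R 0) / of_real \<epsilon>"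
    have "norm (moll u R (\<epsilon> *\<^sub>R e) - moll u R 0) \<le> 2 * (c * (N * Q) + D * A)"
      unfolding mult_2 by (rule order.trans[OF norm_triangle_ineq4 add_mono[OF R1 R0]])
    then have quot: "norm quot \<le> 2 * (c * (N * Q) + D * A) / \<epsilon>"
      unfolding quot_def norm_divide norm_of_real using \<epsilon> by (simp add: divide_right_mono)
    \<comment> \<open>Telescoping: from u(e) to its small average, to the wide average, to the
      increment of wide averages compared with the quotient at \<epsilon>. The wide averages at 0
      and \<epsilon> e are controlled by the small ones there.\<close>
    have "c * u e = - (moll u \<delta> e - c * u e) - (moll u R e - moll u \<delta> e)
        + ((moll u R e - moll u R 0) - quot) + moll u R 0 + quot"
      by simp
    then have "norm (c * u e) \<le> norm (moll u \<delta> e - c * u e) + norm (moll u R e - moll u \<delta> e)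
        + norm ((moll u R e - moll u R 0) - quot) + norm (moll u R 0) + norm quot"
      by (smt (verit) norm_triangle_ineq norm_triangle_ineq4 norm_minus_cancel)
    also have "\<dots> \<le> c * (2 * N * Q + 2 * H * Y) / 2 + D * A + K * N * \<kappa>\<^sup>2 + (c * (N * Q) + D * A)
        + 2 * (c * (N * Q) + D * A) / \<epsilon>"
      using near2 scales[OF l1_pts(1)] far R0 quot unfolding quot_def by linarith
    also have "\<dots> = c * (N * (Q * (2 + 2 / \<epsilon>)) + N * (K / c * \<kappa>\<^sup>2) + H * Y + D / c * (2 + 2 / \<epsilon>) * A)"
      using c by (simp add: algebra_simps add_divide_distrib)
    finally have "norm (u e) \<le> N * (Q * (2 + 2 / \<epsilon>)) + N * (K / c * \<kappa>\<^sup>2) + H * Y + D / c * (2 + 2 / \<epsilon>) * A"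
      using c by (simp add: norm_mult)
    \<comment> \<open>The choices of \<epsilon> and \<kappa> give each of the two factors of N a
      quarter of \<kappa>^\<eta>.\<close>
    also have "\<dots> \<le> N * (\<kappa> powr \<eta> / 4) + N * (\<kappa> powr \<eta> / 4) + H * C + C * A"
    proof (intro add_mono mult_left_mono mult_right_mono NAH C)
      have "Q * (2 + 2 / \<epsilon>) \<le> Q * (4 / \<epsilon>)"
        using \<epsilon> by (intro mult_left_mono) (auto simp: Q_def field_simps)
      also have "\<dots> = 4 * Y * \<epsilon> powr (\<eta> - 1) * \<kappa> powr \<eta>"
        using d \<epsilon> \<kappa> by (simp add: Q_def Y_def \<delta>_def powr_mult powr_diff)
      also have "\<dots> \<le> 1 / 4 * \<kappa> powr \<eta>" by (intro mult_right_mono \<epsilon>) simp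
      finally show "Q * (2 + 2 / \<epsilon>) \<le> \<kappa> powr \<eta> / 4" by simp
      have "K / c * \<kappa>\<^sup>2 = K / c * \<kappa> powr (2 - \<eta>) * \<kappa> powr \<eta>"
        using \<kappa> by (simp flip: powr_add)
      also have "\<dots> \<le> 1 / 4 * \<kappa> powr \<eta>" by (intro mult_right_mono \<kappa>) simp
      finally show "K / c * \<kappa>\<^sup>2 \<le> \<kappa> powr \<eta> / 4" by simp
    qed
    also have "\<dots> = \<kappa> powr \<eta> * N / 2 + C * (A + H)" by (simp add: algebra_simps)
    finally show ?thesis .
  qed
  with that \<kappa>(1) C(1) show ?thesis by blast
qed

section \<open>From germs to a single base point\<close>

lemma monomial_midpoint:
  fixes y v :: "real^'n::finite" and \<beta> :: "'n \<Rightarrow> nat"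
  assumes "(\<Sum>i\<in>UNIV. \<beta> i) \<le> 1"
  shows "(\<Prod>i\<in>UNIV. ((y + v) $ i) ^ \<beta> i) + (\<Prod>i\<in>UNIV. ((y - v) $ i) ^ \<beta> i)
    = 2 * (\<Prod>i\<in>UNIV. (y $ i) ^ \<beta> i)"
proof (cases "\<forall>i. \<beta> i = 0")
  case True
  then show ?thesis by simp
next
  case False
  then obtain j where j: "\<beta> j \<noteq> 0" by auto
  \<comment> \<open>A nonzero multi-index of degree at most one is a unit vector, so its monomial is
    a coordinate.\<close>
  have "\<beta> j + (\<Sum>i\<in>UNIV - {j}. \<beta> i) \<le> 1"
    using assms by (simp add: sum.remove[of UNIV j])
  with j have "\<beta> j = 1" and "(\<Sum>i\<in>UNIV - {j}. \<beta> i) = 0"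
    by linarith+
  then have \<beta>: "\<beta> j = 1" "\<forall>i\<in>UNIV - {j}. \<beta> i = 0"
    by (simp_all only: sum_eq_0_iff finite_Diff finite_UNIV finite)
  have *: "(\<Prod>i\<in>UNIV. (w $ i) ^ \<beta> i) = w $ j" for w :: "real^'n"
    using \<beta> by (simp add: prod.remove[of UNIV j])
  show ?thesis unfolding * by simp
qed

text \<open>Affine functions have zero second differences; this removes the unknown polynomial from
  the Hoelder-type seminorm.\<close>

lemma spolys_midpoint:
  assumes "P \<in> spolys (\<lambda>_. 1) 1"
  shows "P (y + v) + P (y - v) = 2 * P y"
proof -
  obtain a where P: "P = spoly (\<lambda>_. 1) 1 a" using assms by (auto simp: spolys_def)
  have "a \<beta> * of_real (\<Prod>i\<in>UNIV. ((y + v) $ i) ^ \<beta> i) + a \<beta> * of_real (\<Prod>i\<in>UNIV. ((y - v) $ i) ^ \<beta> i)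
      = 2 * (a \<beta> * of_real (\<Prod>i\<in>UNIV. (y $ i) ^ \<beta> i))" if "sdeg (\<lambda>_. 1) \<beta> \<le> 1" for \<beta>
  proof -
    have "complex_of_real (\<Prod>i\<in>UNIV. ((y + v) $ i) ^ \<beta> i) + of_real (\<Prod>i\<in>UNIV. ((y - v) $ i) ^ \<beta> i)
        = of_real (2 * (\<Prod>i\<in>UNIV. (y $ i) ^ \<beta> i))"
      unfolding of_real_add [symmetric] using that
      by (subst monomial_midpoint) (simp_all add: sdeg_def)
    then show ?thesis by (simp only: distrib_left [symmetric] of_real_mult of_real_numeral mult.left_commute)
  qed
  then show ?thesis
    by (simp only: P spoly_def sum_distrib_left flip: sum.distrib) (rule sum.cong, auto)
qed

text \<open>Under y = x + r w the Jacobian r^d cancels the prefactor r^(-d) of the rescaled test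
  function, and the two derivatives leave r^(-2).\<close>

lemma lap_germ_rescale:
  fixes U :: "real^'n::finite \<Rightarrow> real^'n \<Rightarrow> complex"
  assumes U: "continuous_on UNIV (U x)" and \<phi>: "smooth_fun \<phi>" and r: "r > 0"
  shows "lap_germ U x (rescale (\<lambda>_. 1) \<phi> x r)
    = of_real (1 / r\<^sup>2) * (LINT w|lborel. U x (x + r *\<^sub>R w) * of_real (laplacian \<phi> w))"
proof -
  let ?k = "r powr (- real CARD('n))"
  have rescale: "rescale (\<lambda>_. 1) \<phi> x r = (\<lambda>y. ?k * \<phi> ((1 / r) *\<^sub>R (y - x)))"
  proof
    fix y
    have "(\<chi> i. r powr (- real 1) * (y $ i - x $ i)) = (1 / r) *\<^sub>R (y - x)"
      using r by (simp add: vec_eq_iff powr_minus divide_inverse)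
    then show "rescale (\<lambda>_. 1) \<phi> x r y = ?k * \<phi> ((1 / r) *\<^sub>R (y - x))"
      by (simp add: rescale_def)
  qed
  have lap: "laplacian (rescale (\<lambda>_. 1) \<phi> x r) y = ?k * ((1 / r)\<^sup>2 * laplacian \<phi> ((1 / r) *\<^sub>R (y - x)))" for y
    unfolding rescale laplacian_cmult[OF smooth_fun_affine[OF \<phi>]] laplacian_affine[OF \<phi>] ..
  have "continuous_on UNIV (\<lambda>y. U x y * complex_of_real (?k * ((1 / r)\<^sup>2 * laplacian \<phi> ((1 / r) *\<^sub>R (y - x)))))"
    by (intro continuous_intros U continuous_on_compose2[OF smooth_fun_laplacian_continuous[OF \<phi>]]) auto
  then have meas: "(\<lambda>y. U x y * complex_of_real (?k * ((1 / r)\<^sup>2 * laplacian \<phi> ((1 / r) *\<^sub>R (y - x)))))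
      \<in> borel_measurable borel"
    by (rule borel_measurable_continuous_onI)
  have "lap_germ U x (rescale (\<lambda>_. 1) \<phi> x r) = \<bar>r\<bar> ^ CARD('n) *\<^sub>R (LINT w|lborel.
      U x (x + r *\<^sub>R w) * complex_of_real (?k * ((1 / r)\<^sup>2 * laplacian \<phi> ((1 / r) *\<^sub>R (x + r *\<^sub>R w - x)))))"
    unfolding lap_germ_def lap
    using lborel_integral_affine[OF _ meas, of r x] r by simp
  also have "(\<lambda>w. U x (x + r *\<^sub>R w) * complex_of_real (?k * ((1 / r)\<^sup>2 * laplacian \<phi> ((1 / r) *\<^sub>R (x + r *\<^sub>R w - x)))))
      = (\<lambda>w. complex_of_real (?k * (1 / r)\<^sup>2) * (U x (x + r *\<^sub>R w) * complex_of_real (laplacian \<phi> w)))"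
    using r by (auto simp: fun_eq_iff)
  also have "\<bar>r\<bar> ^ CARD('n) *\<^sub>R (LINT w|lborel.
      complex_of_real (?k * (1 / r)\<^sup>2) * (U x (x + r *\<^sub>R w) * complex_of_real (laplacian \<phi> w)))
      = of_real (r ^ CARD('n) * ?k * (1 / r)\<^sup>2) * (LINT w|lborel. U x (x + r *\<^sub>R w) * of_real (laplacian \<phi> w))"
    using r unfolding integral_mult_right_zero by (simp add: scaleR_conv_of_real)
  also have "r ^ CARD('n) * ?k * (1 / r)\<^sup>2 = 1 / r\<^sup>2"
    using r by (simp add: powr_minus powr_realpow power_divide)
  finally show ?thesis .
qed

text \<open>The conditions behind the infima and the supremum, with real constants, so that the
  analysis stays outside \<open>ennreal\<close>.\<close>

definition germ_bounds ::
    "real \<Rightarrow> real \<Rightarrow> (real^'n::finite \<Rightarrow> real^'n \<Rightarrow> complex) \<Rightarrow> real \<Rightarrow> real \<Rightarrow> real \<Rightarrow> bool" where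
  "germ_bounds \<alpha> \<eta> U N A H \<longleftrightarrow> (\<forall>x. continuous_on UNIV (U x)) \<and> 0 \<le> N \<and> 0 \<le> A \<and> 0 \<le> H \<and>
     (\<forall>x y. norm (U x y) \<le> N * sdist (\<lambda>_. 1) x y powr \<eta>) \<and>
     (\<forall>x y. \<exists>P\<in>spolys (\<lambda>_. 1) (nat \<lfloor>\<eta>\<rfloor>). \<forall>z. norm (U x z - U y z - P z)
        \<le> H * sdist (\<lambda>_. 1) y z powr \<alpha> * (sdist (\<lambda>_. 1) x y + sdist (\<lambda>_. 1) y z) powr (\<eta> - \<alpha>)) \<and>
     (\<forall>\<phi> x r. \<phi> \<in> testB (\<lambda>_. 1) (\<eta> - 2) \<longrightarrow> r > 0 \<longrightarrow>
        r powr (- (\<eta> - 2)) * norm (lap_germ U x (rescale (\<lambda>_. 1) \<phi> x r)) \<le> A)"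

text \<open>All three bounds are homogeneous of degree \<eta>: w -> \<rho>^(-\<eta>) U_x(x + \<rho>
  w) satisfies them with unchanged N, A and H. The factor \<rho> is chosen to place y at l1 distance
  \<kappa> from the origin.\<close>

lemma germ_estimate:
  fixes \<alpha> \<eta> :: real
  assumes \<alpha>: "0 < \<alpha>" "\<alpha> < 1" and \<eta>: "1 < \<eta>" "\<eta> < 2"
  obtains C where "0 < C"
    "\<And>(U :: real^'n::finite \<Rightarrow> real^'n \<Rightarrow> complex) N A H x y. germ_bounds \<alpha> \<eta> U N A H \<Longrightarrow>
      norm (U x y) \<le> (N / 2 + C * (A + H)) * sdist (\<lambda>_. 1) x y powr \<eta>"
proof -
  obtain \<kappa> C where \<kappa>: "0 < \<kappa>" and C: "0 < C" and bound:
    "\<And>(u :: real^'n \<Rightarrow> complex) e N A H. pointwise_bounds \<alpha> \<eta> u e N A H \<Longrightarrow> l1 e = \<kappa> \<Longrightarrow>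
      norm (u e) \<le> \<kappa> powr \<eta> * N / 2 + C * (A + H)"
    using pointwise_estimate[OF \<alpha> \<eta>, where 'n = 'n] by blast
  have floor: "nat \<lfloor>\<eta>\<rfloor> = 1"
  proof -
    have "\<lfloor>\<eta>\<rfloor> = 1" using \<eta> by (intro floor_unique) auto
    then show ?thesis by simp
  qed
  have *: "norm (U x y) \<le> (N / 2 + C / \<kappa> powr \<eta> * (A + H)) * l1 (y - x) powr \<eta>"
    if gb: "germ_bounds \<alpha> \<eta> U N A H" for U :: "real^'n \<Rightarrow> real^'n \<Rightarrow> complex" and N A H x y
  proof -
    have U: "continuous_on UNIV (U x)" and NAH: "0 \<le> N" "0 \<le> A" "0 \<le> H"
      and growth: "norm (U x y) \<le> N * l1 (y - x) powr \<eta>"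
      and holder: "\<exists>P\<in>spolys (\<lambda>_. 1) (nat \<lfloor>\<eta>\<rfloor>). \<forall>z. norm (U x z - U y z - P z)
         \<le> H * l1 (z - y) powr \<alpha> * (l1 (y - x) + l1 (z - y)) powr (\<eta> - \<alpha>)"
      and lap: "\<phi> \<in> testB (\<lambda>_. 1) (\<eta> - 2) \<Longrightarrow> r > 0 \<Longrightarrow>
         r powr (- (\<eta> - 2)) * norm (lap_germ U x (rescale (\<lambda>_. 1) \<phi> x r)) \<le> A" for x y r \<phi>
      using gb unfolding germ_bounds_def sdist_eq_l1 by blast+
    show ?thesis
    proof (cases "x = y")
      case True
      then show ?thesis using growth[of x y] by (simp add: l1_def)
    next
      case False
      \<comment> \<open>At coinciding points the growth bound is zero, as
        \<open>0 powr \<eta>\<close> is 0.\<close>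
      have diag: "U y y = 0" using growth[of y y] by (simp add: l1_def)
      define \<rho> where "\<rho> = l1 (y - x) / \<kappa>"
      have "l1 (y - x) > 0" using norm_le_l1[of "y - x"] False
        by (metis eq_iff_diff_eq_0 less_le_trans zero_less_norm_iff)
      then have \<rho>: "\<rho> > 0" "l1 (y - x) = \<rho> * \<kappa>" using \<kappa> by (auto simp: \<rho>_def)
      define e where "e = (1 / \<rho>) *\<^sub>R (y - x)"
      have e: "l1 e = \<kappa>" "x + \<rho> *\<^sub>R e = y" using \<rho> by (auto simp: e_def l1_scaleR)
      define s where "s = complex_of_real (\<rho> powr (- \<eta>))"
      have norm_s: "norm s = \<rho> powr (- \<eta>)" by (simp add: s_def)
      have s_cancel: "\<rho> powr (- \<eta>) * \<rho> powr \<eta> = 1"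
        using \<rho> by (simp flip: powr_add)
      define u where "u w = s * U x (x + \<rho> *\<^sub>R w)" for w
      obtain P where P: "P \<in> spolys (\<lambda>_. 1) 1" "\<And>z. norm (U x z - U y z - P z)
           \<le> H * l1 (z - y) powr \<alpha> * (l1 (y - x) + l1 (z - y)) powr (\<eta> - \<alpha>)"
        using holder[of x y] unfolding floor by blast
      have "norm (u e) \<le> \<kappa> powr \<eta> * N / 2 + C * (A + H)"
      proof (rule bound[OF _ e(1)], unfold pointwise_bounds_def, intro conjI NAH allI ballI)
        show "continuous_on UNIV u"
          unfolding u_def by (intro continuous_intros continuous_on_compose2[OF U]) auto
      next
        fix w :: "real^'n"
        have "norm (u w) \<le> \<rho> powr (- \<eta>) * (N * (\<rho> * l1 w) powr \<eta>)"
          unfolding u_def norm_mult norm_s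
          using growth[of x "x + \<rho> *\<^sub>R w"] \<rho> by (intro mult_left_mono) (auto simp: l1_scaleR)
        also have "\<dots> = (\<rho> powr (- \<eta>) * \<rho> powr \<eta>) * (N * l1 w powr \<eta>)"
          using \<rho> l1_nonneg[of w] by (simp add: powr_mult)
        finally show "norm (u w) \<le> N * l1 w powr \<eta>" unfolding s_cancel by simp
      next
        fix w :: "real^'n"
        let ?v = "\<rho> *\<^sub>R w"
        let ?E = "H * (\<rho> * l1 w) powr \<alpha> * (\<rho> * \<kappa> + \<rho> * l1 w) powr (\<eta> - \<alpha>)"
        \<comment> \<open>At z = y the right side vanishes (\<open>0 powr \<alpha>\<close> is 0),
          and U_y(y) = 0; so P(y) is forced to be U_x(y).\<close>
        have Py: "P y = U x y" using P(2)[of y] diag by (simp add: l1_def)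
        \<comment> \<open>The midpoint identity trades 2 U_x(y) = 2 P(y) for P(y + v) + P(y - v).
          The leftover values of U_y are controlled by growth from the base point y.\<close>
        have "U x (y + ?v) + U x (y - ?v) - 2 * U x y =
            (U x (y + ?v) - U y (y + ?v) - P (y + ?v)) + (U x (y - ?v) - U y (y - ?v) - P (y - ?v))
            + U y (y + ?v) + U y (y - ?v)"
          using spolys_midpoint[OF P(1), of y ?v] by (simp add: Py algebra_simps)
        then have "norm (U x (y + ?v) + U x (y - ?v) - 2 * U x y) \<le>
            norm (U x (y + ?v) - U y (y + ?v) - P (y + ?v)) + norm (U x (y - ?v) - U y (y - ?v) - P (y - ?v))
            + norm (U y (y + ?v)) + norm (U y (y - ?v))"
          by (smt (verit) norm_triangle_ineq)
        also have "\<dots> \<le> ?E + ?E + N * (\<rho> * l1 w) powr \<eta> + N * (\<rho> * l1 w) powr \<eta>"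
        proof -
          have "l1 (- ?v) = \<rho> * l1 w" using \<rho> l1_scaleR[of "- \<rho>" w] by simp
          then show ?thesis
            using P(2)[of "y + ?v"] P(2)[of "y - ?v"] growth[of y "y + ?v"] growth[of y "y - ?v"] \<rho>
            by (intro add_mono) (auto simp: l1_scaleR)
        qed
        also have "?E = \<rho> powr \<eta> * (H * (l1 w powr \<alpha> * (\<kappa> + l1 w) powr (\<eta> - \<alpha>)))"
        proof -
          have "\<rho> * \<kappa> + \<rho> * l1 w = \<rho> * (\<kappa> + l1 w)" by (simp add: algebra_simps)
          moreover have "\<rho> powr \<eta> = \<rho> powr \<alpha> * \<rho> powr (\<eta> - \<alpha>)" using \<rho> by (simp flip: powr_add)
          ultimately show ?thesis using \<rho> \<kappa> l1_nonneg[of w] by (simp add: powr_mult)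
        qed
        also have "N * (\<rho> * l1 w) powr \<eta> = \<rho> powr \<eta> * (N * l1 w powr \<eta>)"
          using \<rho> l1_nonneg[of w] by (simp add: powr_mult)
        finally have *: "norm (U x (y + ?v) + U x (y - ?v) - 2 * U x y) \<le> \<rho> powr \<eta> *
            (2 * N * l1 w powr \<eta> + 2 * H * (l1 w powr \<alpha> * (\<kappa> + l1 w) powr (\<eta> - \<alpha>)))"
          by (simp add: algebra_simps)
        have pts: "x + \<rho> *\<^sub>R (e + w) = y + ?v" "x + \<rho> *\<^sub>R (e - w) = y - ?v"
          using e(2) by (simp_all add: scaleR_add_right scaleR_diff_right add.assoc[symmetric] add_diff_eq)
        have "u (e + w) + u (e - w) - 2 * u e = s * (U x (y + ?v) + U x (y - ?v) - 2 * U x y)"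
          unfolding u_def pts e(2) by (simp add: algebra_simps)
        then have "norm (u (e + w) + u (e - w) - 2 * u e) \<le> \<rho> powr (- \<eta>) * (\<rho> powr \<eta> *
            (2 * N * l1 w powr \<eta> + 2 * H * (l1 w powr \<alpha> * (\<kappa> + l1 w) powr (\<eta> - \<alpha>))))"
          using * by (simp add: norm_mult norm_s mult_left_mono)
        then show "norm (u (e + w) + u (e - w) - 2 * u e)
           \<le> 2 * N * l1 w powr \<eta> + 2 * H * (l1 w powr \<alpha> * (l1 e + l1 w) powr (\<eta> - \<alpha>))"
          unfolding mult.assoc[symmetric] s_cancel e(1) by simp
      next
        fix \<phi> :: "real^'n \<Rightarrow> real" assume \<phi>: "\<phi> \<in> testB (\<lambda>_. 1) (\<eta> - 2)"
        then have smooth: "smooth_fun \<phi>" by (simp add: testB_def)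
        have "(LINT w|lborel. u w * of_real (laplacian \<phi> w)) =
            s * (LINT w|lborel. U x (x + \<rho> *\<^sub>R w) * of_real (laplacian \<phi> w))"
          unfolding u_def mult.assoc by (rule integral_mult_right_zero)
        also have "norm \<dots> = \<rho> powr (- \<eta>) * norm (LINT w|lborel. U x (x + \<rho> *\<^sub>R w) * of_real (laplacian \<phi> w))"
          by (simp add: norm_mult norm_s)
        also have "\<rho> powr (- \<eta>) = \<rho> powr (- (\<eta> - 2)) * (1 / \<rho>\<^sup>2)"
          using \<rho> by (simp add: powr_diff powr_minus divide_inverse)
        also have "\<dots> * norm (LINT w|lborel. U x (x + \<rho> *\<^sub>R w) * of_real (laplacian \<phi> w))
            = \<rho> powr (- (\<eta> - 2)) * norm (lap_germ U x (rescale (\<lambda>_. 1) \<phi> x \<rho>))"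
          unfolding lap_germ_rescale[of U x \<phi> \<rho>, OF U smooth \<rho>(1)] norm_mult norm_of_real by simp
        also have "\<dots> \<le> A" by (rule lap[OF \<phi> \<rho>(1)])
        finally show "norm (LINT w|lborel. u w * of_real (laplacian \<phi> w)) \<le> A" .
      qed
      also have "norm (u e) = \<rho> powr (- \<eta>) * norm (U x y)"
        by (simp add: u_def e(2) norm_mult norm_s)
      finally have "\<rho> powr \<eta> * (\<rho> powr (- \<eta>) * norm (U x y)) \<le> \<rho> powr \<eta> * (\<kappa> powr \<eta> * N / 2 + C * (A + H))"
        by (intro mult_left_mono) auto
      then have "norm (U x y) \<le> \<rho> powr \<eta> * (\<kappa> powr \<eta> * N / 2 + C * (A + H))"
        unfolding mult.assoc[symmetric] using s_cancel by (simp add: mult.commute)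
      \<comment> \<open>Returning to the original scale cancels \<kappa>^\<eta> in front of N, so
        exactly N / 2 remains; the other constant becomes C / \<kappa>^\<eta>.\<close>
      also have "\<dots> = (N / 2 + C / \<kappa> powr \<eta> * (A + H)) * (\<rho> * \<kappa>) powr \<eta>"
        using \<kappa> \<rho> by (simp add: powr_mult field_simps)
      finally show ?thesis by (simp add: \<rho>(2))
    qed
  qed
  show ?thesis
    by (rule that[of "C / \<kappa> powr \<eta>"]) (use C \<kappa> in simp, unfold sdist_eq_l1, rule *)
qed

section \<open>Absorbing half of the norm\<close>

theorem theorem2p8:
  fixes \<alpha> \<eta> :: real
  assumes "0 < \<alpha>" "\<alpha> < 1" "1 < \<eta>" "\<eta> < 2"
  shows "\<exists>C>0. \<forall>U :: real^'n::finite \<Rightarrow> real^'n \<Rightarrow> complex.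
           (\<forall>x. continuous_on UNIV (U x)) \<longrightarrow>
           G_norm (\<lambda>_. 1) \<eta> U < \<infinity> \<longrightarrow>
           G_norm (\<lambda>_. 1) \<eta> U \<le>
             ennreal C * (G_dist (\<lambda>_. 1) (\<eta> - 2) (lap_germ U) + G_holder (\<lambda>_. 1) \<eta> \<alpha> U)"
proof -
  obtain C where C: "0 < C" and bound:
    "\<And>(U :: real^'n::finite \<Rightarrow> real^'n \<Rightarrow> complex) N A H x y. germ_bounds \<alpha> \<eta> U N A H \<Longrightarrow>
      norm (U x y) \<le> (N / 2 + C * (A + H)) * sdist (\<lambda>_. 1) x y powr \<eta>"
    using germ_estimate[OF assms, where 'n = 'n] by blast
  have "G_norm (\<lambda>_. 1) \<eta> U \<le>
      ennreal (2 * C) * (G_dist (\<lambda>_. 1) (\<eta> - 2) (lap_germ U) + G_holder (\<lambda>_. 1) \<eta> \<alpha> U)"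
    if U: "\<And>x. continuous_on UNIV (U x)" and fin: "G_norm (\<lambda>_. 1) \<eta> U < \<infinity>"
    for U :: "real^'n \<Rightarrow> real^'n \<Rightarrow> complex"
  \<comment> \<open>An infinite seminorm makes the right side infinite, as the constant is
    positive.\<close>
  proof (cases "G_dist (\<lambda>_. 1) (\<eta> - 2) (lap_germ U) = \<infinity> \<or> G_holder (\<lambda>_. 1) \<eta> \<alpha> U = \<infinity>")
    case True
    then show ?thesis using C by (auto simp: ennreal_mult_top)
  next
    case False
    obtain a where a: "G_dist (\<lambda>_. 1) (\<eta> - 2) (lap_germ U) = ennreal a" "0 \<le> a"
      using False by (cases "G_dist (\<lambda>_. 1) (\<eta> - 2) (lap_germ U)") auto
    obtain h where h: "G_holder (\<lambda>_. 1) \<eta> \<alpha> U = ennreal h" "0 \<le> h"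
      using False by (cases "G_holder (\<lambda>_. 1) \<eta> \<alpha> U") auto
    obtain g where g: "G_norm (\<lambda>_. 1) \<eta> U = ennreal g" "0 \<le> g"
      using fin by (cases "G_norm (\<lambda>_. 1) \<eta> U") auto
    have lap: "r powr (- (\<eta> - 2)) * norm (lap_germ U x (rescale (\<lambda>_. 1) \<phi> x r)) \<le> a"
      if "\<phi> \<in> testB (\<lambda>_. 1) (\<eta> - 2)" "r > 0" for \<phi> x r
    proof -
      have "ennreal (r powr (- (\<eta> - 2)) * norm (lap_germ U x (rescale (\<lambda>_. 1) \<phi> x r))) \<le> ennreal a"
        unfolding a(1)[symmetric] G_dist_def
        by (rule SUP_upper2[of "(\<phi>, x, r)"]) (use that in auto)
      then show ?thesis using a(2) by (simp add: ennreal_le_iff)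
    qed
    have "g \<le> 2 * C * (a + h) + t" if t: "t > 0" for t
    proof -
      \<comment> \<open>The two infima need not be attained, so N and H exceed them by up to t'; the
        accumulated slack is t' (1 + 2 C) = t. The supremum \<open>a\<close> bounds its terms
        without slack.\<close>
      define t' where "t' = t / (1 + 2 * C)"
      have t': "t' > 0" "t' * (1 + 2 * C) = t" using t C by (auto simp: t'_def)
      define S where "S = C * (a + (h + t'))"
      have "G_norm (\<lambda>_. 1) \<eta> U < ennreal (g + t')"
        using g t' by (simp add: ennreal_lessI)
      then obtain N where N: "N < g + t'" "N > 0" "\<And>x y. norm (U x y) \<le> N * sdist (\<lambda>_. 1) x y powr \<eta>"
        unfolding G_norm_def Inf_less_iff by (auto simp: ennreal_less_iff)
      have "G_holder (\<lambda>_. 1) \<eta> \<alpha> U < ennreal (h + t')"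
        using h t' by (simp add: ennreal_lessI)
      then obtain H where H: "H < h + t'" "H > 0" "\<And>x y. \<exists>P\<in>spolys (\<lambda>_. 1) (nat \<lfloor>\<eta>\<rfloor>). \<forall>z. norm (U x z - U y z - P z)
         \<le> H * sdist (\<lambda>_. 1) y z powr \<alpha> * (sdist (\<lambda>_. 1) x y + sdist (\<lambda>_. 1) y z) powr (\<eta> - \<alpha>)"
        unfolding G_holder_def Inf_less_iff by (auto simp: ennreal_less_iff)
      have "norm (U x y) \<le> (N / 2 + C * (a + H)) * sdist (\<lambda>_. 1) x y powr \<eta>" for x y
        by (rule bound) (use N H U a(2) lap in \<open>simp add: germ_bounds_def\<close>)
      moreover have pos: "N / 2 + C * (a + H) > 0"
        using N(2) H(2) a(2) C by (intro add_pos_nonneg mult_nonneg_nonneg) auto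
      ultimately have "G_norm (\<lambda>_. 1) \<eta> U \<le> ennreal (N / 2 + C * (a + H))"
        unfolding G_norm_def by (intro Inf_lower) auto
      then have "g \<le> N / 2 + C * (a + H)"
        using g pos by (simp add: ennreal_le_iff)
      also have "\<dots> \<le> (g + t') / 2 + S"
        unfolding S_def using N(1) H(1) C by (intro add_mono mult_left_mono divide_right_mono) auto
      \<comment> \<open>Finiteness of g allows g / 2 to be subtracted, which doubles the
        constant.\<close>
      finally have "g \<le> t' + 2 * S" by (simp add: field_simps)
      also have "\<dots> = 2 * C * (a + h) + t' * (1 + 2 * C)" by (simp add: S_def algebra_simps)
      finally show ?thesis unfolding t'(2) .
    qed
    then have "g \<le> 2 * C * (a + h)" by (rule field_le_epsilon)
    then have "ennreal g \<le> ennreal (2 * C * (a + h))" by (rule ennreal_leI)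
    then show ?thesis
      unfolding g(1) a(1) h(1) using C a(2) h(2) by (simp add: ennreal_mult)
  qed
  then show ?thesis using C by (intro exI[of _ "2 * C"]) auto
qed

end
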